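(* Let $\mathbf{L}=\{\ell,\mathcal{D}_{\mathbf L}\}$ be a self-adjoint operator on the Hilbert space $L^2[(a,b),w]$ which is an extension of the minimal symmetric operator $\mathbf{L}_{\min}=\{\ell,\mathcal{D}_{\min}\}$, and suppose $\mathbf{L}_{\min}$ has deficiency indices $(m,m)$. Assume that $\mathcal{D}_{\mathbf L}$ includes a complete set of orthogonal eigenfunctions $\{P_k\}_{k=0}^\infty$ of $\mathbf L$. Furthermore, assume that for some indices $k_1,\dots,k_m$ and some $f_1,\dots,f_m\in\mathcal{D}_{\max}$ the collection $\{P_{k_1},\dots,P_{k_m},f_1,\dots,f_m\}$ is a basis modulo $\mathcal{D}_{\min}$ of the sum of defect spaces $\mathcal{D}_+\dotplus\mathcal{D}_-$ (equivalently, the classes of these functions form a basis of $\mathcal{D}_{\max}/\mathcal{D}_{\min}$). Then $\mathcal{D}_{\mathbf L}$ is given by imposing $\{P_{k_1},\dots,P_{k_m}\}$ as GKN conditions on $\mathcal{D}_{\max}$.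
   Context: $\ell$ is a formally symmetric differential expression of even order $2N$ with real coefficients on an interval $(a,b)$ (for example a Sturm--Liouville expression $\ell[f]=-\frac1w\left((pf')'+qf\right)$ with $p,w>0$ a.e., $q$ real, $1/p,q,w\in L^1_{\rm loc}(a,b)$, or a composition power of such an expression). The inner product on $L^2[(a,b),w]$ is $\langle f,g\rangle=\int_a^b f\overline{g}\,w\,dx$. Maximal domain: $\mathcal{D}_{\max}=\{f:(a,b)\to\mathbb{C} : f^{(k)}\in AC_{\rm loc}(a,b),\ k=0,\dots,2N-1;\ f,\ell[f]\in L^2[(a,b),w]\}$. Sesquilinear form: for $f,g\in\mathcal{D}_{\max}$, $[f,g]\big|_a^b=\int_a^b\{\ell[f]\,\overline{g}-\ell[\overline{g}]\,f\}\,w\,dx$. Minimal domain: $\mathcal{D}_{\min}=\{f\in\mathcal{D}_{\max}: [f,g]|_a^b=0 \text{ for all } g\in\mathcal{D}_{\max}\}$. The operators $\mathbf L_{\min}=\{\ell,\mathcal D_{\min}\}$ and $\mathbf L_{\max}=\{\ell,\mathcal D_{\max}\}$ are adjoints of one another. Here $\{\ell,\mathcal X\}$ denotes the operator acting by $\ell$ on the domain $\mathcal X$. Defect spaces: $\mathcal{D}_\pm=\{f\in\mathcal{D}_{\max}:\ell[f]=\pm i f\}$; the deficiency indices are $(\dim\mathcal D_+,\dim\mathcal D_-)$, and $\mathcal D_{\max}=\mathcal D_{\min}\dotplus\mathcal D_+\dotplus\mathcal D_-$ (direct sum). Functions $w_1,\dots,w_r\in\mathcal D_{\max}$ are linearly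 independent modulo $\mathcal D_{\min}$ if $\sum\alpha_iw_i\in\mathcal D_{\min}$ implies all $\alpha_i=0$. "$\mathcal D_{\mathbf L}$ is given by imposing $w_1,\dots,w_m$ as GKN (Glazman--Krein--Naimark) conditions on $\mathcal{D}_{\max}$" means: $w_1,\dots,w_m\in\mathcal D_{\max}$ are linearly independent modulo $\mathcal D_{\min}$, satisfy the Glazman symmetry conditions $[w_i,w_j]|_a^b=0$ for all $i,j=1,\dots,m$, and $\mathcal D_{\mathbf L}=\{f\in\mathcal D_{\max}:[f,w_i]|_a^b=0,\ i=1,\dots,m\}$. *)

theory Defs
  imports "HOL-Analysis.Analysis" "HOL-Library.Function_Algebras"
begin

section \<open>The complex vector space of functions\<close>

interpretation cfun: vector_space "\<lambda>(c::complex) (f :: real \<Rightarrow> complex) x. c * f x"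
  by unfold_locales (auto simp: fun_eq_iff algebra_simps)

definition has_complex_dim :: "(real \<Rightarrow> complex) set \<Rightarrow> nat \<Rightarrow> bool" where
  "has_complex_dim V m \<longleftrightarrow>
     (\<exists>B. cfun.independent B \<and> cfun.span B = V \<and> finite B \<and> card B = m)"

definition lin_indep_mod :: "(real \<Rightarrow> complex) set \<Rightarrow> (real \<Rightarrow> complex) list \<Rightarrow> bool" where
  "lin_indep_mod Z us \<longleftrightarrow>
     (\<forall>\<alpha> :: nat \<Rightarrow> complex. (\<lambda>x. \<Sum>i<length us. \<alpha> i * (us ! i) x) \<in> Z \<longrightarrow>
        (\<forall>i<length us. \<alpha> i = 0))"

text \<open>For subspaces \<open>X\<close> and \<open>Z\<close>, the following says that the classes of \<open>us\<close> modulo \<open>Z\<close> form a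
  basis of the image \<open>(X + Z) / Z\<close> of \<open>X\<close>: they are independent modulo \<open>Z\<close>, and
  \<open>span us + Z = X + Z\<close>.\<close>

definition basis_mod ::
  "(real \<Rightarrow> complex) set \<Rightarrow> (real \<Rightarrow> complex) set \<Rightarrow> (real \<Rightarrow> complex) list \<Rightarrow> bool" where
  "basis_mod Z X us \<longleftrightarrow>
     lin_indep_mod Z us \<and> cfun.span (set us \<union> Z) = cfun.span (X \<union> Z)"


section \<open>Local absolute continuity\<close>

definition abs_cont_on :: "real \<Rightarrow> real \<Rightarrow> (real \<Rightarrow> complex) \<Rightarrow> bool" where
  "abs_cont_on c d f \<longleftrightarrow>
     (\<forall>\<epsilon>>0. \<exists>\<delta>>0. \<forall>(n::nat) s t.
        (\<forall>i<n. c \<le> s i \<and> s i \<le> t i \<and> t i \<le> d) \<and>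
        (\<forall>i<n. \<forall>j<n. i \<noteq> j \<longrightarrow> {s i<..<t i} \<inter> {s j<..<t j} = {}) \<and>
        (\<Sum>i<n. t i - s i) < \<delta> \<longrightarrow>
        (\<Sum>i<n. norm (f (t i) - f (s i))) < \<epsilon>)"

definition ac_loc :: "real set \<Rightarrow> (real \<Rightarrow> complex) \<Rightarrow> bool" where
  "ac_loc I f \<longleftrightarrow> (\<forall>c d. c < d \<and> {c..d} \<subseteq> I \<longrightarrow> abs_cont_on c d f)"

definition L1_loc :: "real set \<Rightarrow> (real \<Rightarrow> real) \<Rightarrow> bool" where
  "L1_loc I u \<longleftrightarrow> (\<forall>c d. c < d \<and> {c..d} \<subseteq> I \<longrightarrow> set_integrable lebesgue {c..d} u)"


section \<open>Differential expressions\<close>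

text \<open>A differential expression of order \<open>n = 2 * N\<close> with real coefficients is given by
  coefficients \<open>coeff r s\<close> with \<open>r < n\<close> and \<open>s \<le> r + 1\<close>; its derivatives are
    \<open>f^[0] = f\<close>,
    \<open>f^[r+1] = ((f^[r])' - (\<Sum>s\<le>r. coeff r s * f^[s])) / coeff r (r+1)\<close>,
  and the expression itself is \<open>\<ell>[f] = f^[n]\<close>. Instances:

  \<^item> With \<open>coeff r (r+1) = 1\<close> and \<open>coeff r s = 0\<close> otherwise for \<open>r < n - 1\<close>, one has
    \<open>f^[k] = f^(k)\<close> for \<open>k < n\<close>, the ordinary derivatives, and the last row
    \<open>coeff (n-1) n = 1 / c_n\<close>, \<open>coeff (n-1) s = - c_s / c_n\<close> gives
    \<open>\<ell>[f] = c_n f^(n) + \<dots> + c_1 f' + c_0 f\<close>.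

  \<^item> The Sturm--Liouville expression \<open>\<ell>[f] = -((p f')' + q f) / w\<close> is \<open>n = 2\<close>,
    \<open>coeff 0 0 = 0\<close>, \<open>coeff 0 1 = 1 / p\<close>, \<open>coeff 1 0 = - q\<close>, \<open>coeff 1 1 = 0\<close>,
    \<open>coeff 1 2 = - w\<close>. Here \<open>f^[1] = p f'\<close>; if \<open>1 / p\<close> is merely locally integrable, this is the
    function that has to be locally absolutely continuous, rather than \<open>f'\<close>.

  \<^item> Composition powers of an expression are obtained by repeating its rows along the diagonal,
    i.e. \<open>f^[n+k] = (\<ell>[f])^[k]\<close>.\<close>

record diff_expr =
  left_end :: ereal
  right_end :: ereal
  weight :: "real \<Rightarrow> real"
  half_order :: nat
  coeff :: "nat \<Rightarrow> nat \<Rightarrow> real \<Rightarrow> real"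

definition dom_int :: "diff_expr \<Rightarrow> real set" where
  "dom_int E = einterval (left_end E) (right_end E)"

definition ord_of :: "diff_expr \<Rightarrow> nat" where
  "ord_of E = 2 * half_order E"

definition regular_expr :: "diff_expr \<Rightarrow> bool" where
  "regular_expr E \<longleftrightarrow>
     left_end E < right_end E \<and>
     half_order E \<ge> 1 \<and>
     L1_loc (dom_int E) (weight E) \<and>
     (AE x in lebesgue. x \<in> dom_int E \<longrightarrow> weight E x > 0) \<and>
     (\<forall>r<ord_of E. \<forall>s\<le>Suc r. L1_loc (dom_int E) (coeff E r s)) \<and>
     (\<forall>r<ord_of E. AE x in lebesgue. x \<in> dom_int E \<longrightarrow> coeff E r (Suc r) x \<noteq> 0)"

text \<open>\<open>F 0, \<dots>, F (n-1)\<close> are the locally absolutely continuous derivatives of \<open>f\<close>, and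
  \<open>F n\<close> represents \<open>\<ell>[f]\<close>. The recursion is written without division. Locally absolutely
  continuous functions are differentiable almost everywhere, so \<open>has_vector_derivative\<close> only
  prescribes the value of the derivative.\<close>

definition derivs_of :: "diff_expr \<Rightarrow> (real \<Rightarrow> complex) \<Rightarrow> (nat \<Rightarrow> real \<Rightarrow> complex) \<Rightarrow> bool" where
  "derivs_of E f F \<longleftrightarrow>
     (\<forall>x\<in>dom_int E. F 0 x = f x) \<and>
     (\<forall>r<ord_of E. ac_loc (dom_int E) (F r)) \<and>
     (\<forall>r<ord_of E. AE x in lebesgue. x \<in> dom_int E \<longrightarrow>
        (F r has_vector_derivative (\<Sum>s\<le>Suc r. complex_of_real (coeff E r s x) * F s x)) (at x))"

text \<open>The leading coefficients being nonzero almost everywhere, \<open>\<ell>[f]\<close> is determined up to a null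
  set (lemma \<open>ell_AE_unique\<close> below); \<open>ell E f\<close> is some representative.\<close>

definition ell :: "diff_expr \<Rightarrow> (real \<Rightarrow> complex) \<Rightarrow> real \<Rightarrow> complex" where
  "ell E f = (SOME h. \<exists>F. derivs_of E f F \<and> h = F (ord_of E))"


section \<open>The weighted Hilbert space and its operators\<close>

text \<open>Elements of the Hilbert space are represented by functions on the real line; only their values
  on the interval matter, and equality in the Hilbert space is \<open>ae_eq\<close>.\<close>

definition L2w :: "diff_expr \<Rightarrow> (real \<Rightarrow> complex) set" where
  "L2w E = {f. set_borel_measurable lebesgue (dom_int E) f \<and>
               set_integrable lebesgue (dom_int E) (\<lambda>x. (norm (f x))\<^sup>2 * weight E x)}"

definition ae_eq :: "diff_expr \<Rightarrow> (real \<Rightarrow> complex) \<Rightarrow> (real \<Rightarrow> complex) \<Rightarrow> bool" where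
  "ae_eq E f g \<longleftrightarrow> (AE x in lebesgue. x \<in> dom_int E \<longrightarrow> f x = g x)"

definition ip :: "diff_expr \<Rightarrow> (real \<Rightarrow> complex) \<Rightarrow> (real \<Rightarrow> complex) \<Rightarrow> complex" where
  "ip E f g = (LINT x:dom_int E|lebesgue. f x * cnj (g x) * complex_of_real (weight E x))"

definition L2norm :: "diff_expr \<Rightarrow> (real \<Rightarrow> complex) \<Rightarrow> real" where
  "L2norm E f = sqrt (LINT x:dom_int E|lebesgue. (norm (f x))\<^sup>2 * weight E x)"

definition dense_L2 :: "diff_expr \<Rightarrow> (real \<Rightarrow> complex) set \<Rightarrow> bool" where
  "dense_L2 E S \<longleftrightarrow>
     (\<forall>g\<in>L2w E. \<forall>\<epsilon>>0. \<exists>f\<in>S. L2norm E (\<lambda>x. g x - f x) < \<epsilon>)"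

text \<open>An operator \<open>{T, D}\<close> is given by its action \<open>T\<close> and its domain \<open>D\<close>. Graphs are
  closed under almost everywhere equality in both components.\<close>

definition op_graph ::
  "diff_expr \<Rightarrow> ((real \<Rightarrow> complex) \<Rightarrow> real \<Rightarrow> complex) \<Rightarrow> (real \<Rightarrow> complex) set
     \<Rightarrow> ((real \<Rightarrow> complex) \<times> (real \<Rightarrow> complex)) set" where
  "op_graph E T D = {(g, h). g \<in> L2w E \<and> h \<in> L2w E \<and> (\<exists>f\<in>D. ae_eq E g f \<and> ae_eq E h (T f))}"

definition adjoint_graph ::
  "diff_expr \<Rightarrow> ((real \<Rightarrow> complex) \<Rightarrow> real \<Rightarrow> complex) \<Rightarrow> (real \<Rightarrow> complex) set
     \<Rightarrow> ((real \<Rightarrow> complex) \<times> (real \<Rightarrow> complex)) set" where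
  "adjoint_graph E T D =
     {(g, h). g \<in> L2w E \<and> h \<in> L2w E \<and> (\<forall>f\<in>D. ip E (T f) g = ip E f h)}"

definition self_adjoint_op ::
  "diff_expr \<Rightarrow> ((real \<Rightarrow> complex) \<Rightarrow> real \<Rightarrow> complex) \<Rightarrow> (real \<Rightarrow> complex) set \<Rightarrow> bool" where
  "self_adjoint_op E T D \<longleftrightarrow>
     cfun.subspace D \<and> dense_L2 E D \<and> adjoint_graph E T D = op_graph E T D"


section \<open>Maximal and minimal domains, defect spaces, GKN conditions\<close>

text \<open>A function on the interval is represented by its extension by zero, so that elements of the
  maximal domain are equal iff they agree on the interval.\<close>

definition Dmax :: "diff_expr \<Rightarrow> (real \<Rightarrow> complex) set" where
  "Dmax E = {f. (\<forall>x. x \<notin> dom_int E \<longrightarrow> f x = 0) \<and> (\<exists>F. derivs_of E f F) \<and>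
                f \<in> L2w E \<and> ell E f \<in> L2w E}"

definition sform :: "diff_expr \<Rightarrow> (real \<Rightarrow> complex) \<Rightarrow> (real \<Rightarrow> complex) \<Rightarrow> complex" where
  "sform E f g =
     (LINT x:dom_int E|lebesgue.
        (ell E f x * cnj (g x) - ell E (\<lambda>y. cnj (g y)) x * f x) * complex_of_real (weight E x))"

text \<open>Formal symmetry: integration by parts against functions with compact support in the open
  interval produces no boundary terms and leads back to the same expression.\<close>

definition formally_symmetric :: "diff_expr \<Rightarrow> bool" where
  "formally_symmetric E \<longleftrightarrow>
     (\<forall>f\<in>Dmax E. \<forall>g\<in>Dmax E. \<forall>K. compact K \<and> K \<subseteq> dom_int E \<and>
        (\<forall>x. x \<notin> K \<longrightarrow> f x = 0 \<and> g x = 0) \<longrightarrow>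
        ip E (ell E f) g = ip E f (ell E g))"

definition Dmin :: "diff_expr \<Rightarrow> (real \<Rightarrow> complex) set" where
  "Dmin E = {f \<in> Dmax E. \<forall>g\<in>Dmax E. sform E f g = 0}"

definition Dplus :: "diff_expr \<Rightarrow> (real \<Rightarrow> complex) set" where
  "Dplus E = {f \<in> Dmax E. ae_eq E (ell E f) (\<lambda>x. \<i> * f x)}"

definition Dminus :: "diff_expr \<Rightarrow> (real \<Rightarrow> complex) set" where
  "Dminus E = {f \<in> Dmax E. ae_eq E (ell E f) (\<lambda>x. - \<i> * f x)}"

definition deficiency_indices :: "diff_expr \<Rightarrow> nat \<Rightarrow> nat \<Rightarrow> bool" where
  "deficiency_indices E m m' \<longleftrightarrow> has_complex_dim (Dplus E) m \<and> has_complex_dim (Dminus E) m'"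

definition defect_sum :: "diff_expr \<Rightarrow> (real \<Rightarrow> complex) set" where
  "defect_sum E = {\<lambda>x. f x + g x | f g. f \<in> Dplus E \<and> g \<in> Dminus E}"

definition complete_orthogonal_eigenfunctions ::
  "diff_expr \<Rightarrow> ((real \<Rightarrow> complex) \<Rightarrow> real \<Rightarrow> complex) \<Rightarrow> (real \<Rightarrow> complex) set
     \<Rightarrow> (nat \<Rightarrow> real \<Rightarrow> complex) \<Rightarrow> bool" where
  "complete_orthogonal_eigenfunctions E T D P \<longleftrightarrow>
     (\<forall>k. P k \<in> D \<and> \<not> ae_eq E (P k) (\<lambda>x. 0) \<and>
          (\<exists>\<mu> :: complex. ae_eq E (T (P k)) (\<lambda>x. \<mu> * P k x))) \<and>
     (\<forall>j k. j \<noteq> k \<longrightarrow> ip E (P j) (P k) = 0) \<and>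
     dense_L2 E (cfun.span (range P))"

definition given_by_GKN :: "diff_expr \<Rightarrow> (real \<Rightarrow> complex) set \<Rightarrow> (real \<Rightarrow> complex) list \<Rightarrow> bool" where
  "given_by_GKN E D ws \<longleftrightarrow>
     set ws \<subseteq> Dmax E \<and>
     lin_indep_mod (Dmin E) ws \<and>
     (\<forall>u\<in>set ws. \<forall>v\<in>set ws. sform E u v = 0) \<and>
     D = {f \<in> Dmax E. \<forall>v\<in>set ws. sform E f v = 0}"


section \<open>The differential expression is well defined up to null sets\<close>

lemma ac_loc_continuous_on:
  assumes "open I" "ac_loc I f" shows "continuous_on I f"
proof -
  have "isCont f x" if x: "x \<in> I" for x
  proof -
    obtain e where e: "e > 0" "cball x e \<subseteq> I"
      using assms(1) x open_contains_cball by blast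
    have sub: "{x - e..x + e} \<subseteq> I" using e(2) by (simp add: cball_eq_atLeastAtMost)
    have ac: "abs_cont_on (x - e) (x + e) f"
      using assms(2) sub e(1) unfolding ac_loc_def by simp
    show "isCont f x"
      unfolding continuous_at_eps_delta
    proof (intro allI impI)
      fix r :: real assume "r > 0"
      from ac[unfolded abs_cont_on_def, THEN spec, THEN mp, OF this]
      obtain d where d: "d > 0" and
        D: "\<forall>(n::nat) s t. (\<forall>i<n. x - e \<le> s i \<and> s i \<le> t i \<and> t i \<le> x + e) \<and>
        (\<forall>i<n. \<forall>j<n. i \<noteq> j \<longrightarrow> {s i<..<t i} \<inter> {s j<..<t j} = {}) \<and>
        (\<Sum>i<n. t i - s i) < d \<longrightarrow> (\<Sum>i<n. norm (f (t i) - f (s i))) < r"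
        by (elim exE conjE)
      have "dist (f y) (f x) < r" if y: "dist y x < min d e" for y
      proof -
        have le: "\<bar>y - x\<bar> < d" "\<bar>y - x\<bar> < e"
          using y by (simp_all add: dist_real_def)
        have bounds: "x - e \<le> min x y" "min x y \<le> max x y" "max x y \<le> x + e"
          "max x y - min x y < d"
          using le e(1) by linarith+
        have "(\<Sum>i<(1::nat). norm (f (max x y) - f (min x y))) < r"
          using bounds by (intro D[THEN spec, THEN spec, THEN spec, THEN mp]) simp
        then show ?thesis
          by (cases "x \<le> y") (simp_all add: dist_norm norm_minus_commute)
      qed
      then show "\<exists>d>0. \<forall>y. dist y x < d \<longrightarrow> dist (f y) (f x) < r"
        using d e(1) by (intro exI[of _ "min d e"]) auto
    qed
  qed
  then show ?thesis by (simp add: continuous_at_imp_continuous_on)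
qed

lemma continuous_AE_eq_imp_eq:
  fixes f g :: "real \<Rightarrow> complex"
  assumes "open I" "continuous_on I f" "continuous_on I g"
    and "AE x in lebesgue. x \<in> I \<longrightarrow> f x = g x" and "x \<in> I"
  shows "f x = g x"
proof (rule ccontr)
  assume neq: "f x \<noteq> g x"
  let ?S = "{x \<in> I. f x - g x \<in> - {0}}"
  have "open ?S"
    using continuous_open_preimage[OF continuous_on_diff[OF assms(2,3)] assms(1)
        open_Compl[OF closed_singleton[of "0 :: complex"]]]
    by (simp add: vimage_def Int_def)
  moreover obtain N where "N \<in> null_sets lebesgue" "?S \<subseteq> N"
    using assms(4) by (auto simp: eventually_ae_filter)
  then have "negligible ?S"
    using negligible_iff_null_sets negligible_subset by blast
  ultimately show False
    using open_not_negligible[of ?S] neq assms(5) by auto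
qed

lemma derivs_of_unique:
  assumes reg: "regular_expr E" and F: "derivs_of E f F" and G: "derivs_of E f G"
  shows "r < ord_of E \<Longrightarrow> \<forall>x\<in>dom_int E. F r x = G r x"
    and "ae_eq E (F (ord_of E)) (G (ord_of E))"
proof -
  have opn: "open (dom_int E)" by (simp add: dom_int_def)
  have step: "AE x in lebesgue. x \<in> dom_int E \<longrightarrow> F (Suc r) x = G (Suc r) x"
    if r: "r < ord_of E" and eq: "\<forall>s\<le>r. \<forall>x\<in>dom_int E. F s x = G s x" for r
  proof -
    have dF: "AE x in lebesgue. x \<in> dom_int E \<longrightarrow> (F r has_vector_derivative
        (\<Sum>s\<le>Suc r. complex_of_real (coeff E r s x) * F s x)) (at x)"
      and dG: "AE x in lebesgue. x \<in> dom_int E \<longrightarrow> (G r has_vector_derivative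
        (\<Sum>s\<le>Suc r. complex_of_real (coeff E r s x) * G s x)) (at x)"
      and nz: "AE x in lebesgue. x \<in> dom_int E \<longrightarrow> coeff E r (Suc r) x \<noteq> 0"
      using F G reg r unfolding derivs_of_def regular_expr_def by blast+
    show ?thesis
      using dF dG nz
    proof eventually_elim
      case (elim x)
      show ?case
      proof
        assume x: "x \<in> dom_int E"
        have "(F r has_vector_derivative
            (\<Sum>s\<le>Suc r. complex_of_real (coeff E r s x) * G s x)) (at x)"
          using elim(2) x eq opn
          by (intro has_vector_derivative_transform_within_open[of "G r" _ x "dom_int E" "F r"]) auto
        then have "(\<Sum>s\<le>Suc r. complex_of_real (coeff E r s x) * F s x) =
            (\<Sum>s\<le>Suc r. complex_of_real (coeff E r s x) * G s x)"
          using elim(1) x vector_derivative_unique_at by blast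
        moreover have "(\<Sum>s\<le>r. complex_of_real (coeff E r s x) * F s x) =
            (\<Sum>s\<le>r. complex_of_real (coeff E r s x) * G s x)"
          using eq x by (intro sum.cong) auto
        ultimately show "F (Suc r) x = G (Suc r) x"
          using elim(3) x by simp
      qed
    qed
  qed
  have main: "r < ord_of E \<longrightarrow> (\<forall>x\<in>dom_int E. F r x = G r x)" for r
  proof (induction r rule: less_induct)
    case (less r)
    show ?case
    proof (cases r)
      case 0
      then show ?thesis using F G by (simp add: derivs_of_def)
    next
      case (Suc q)
      show ?thesis
      proof (intro impI ballI)
        fix x assume r: "r < ord_of E" and x: "x \<in> dom_int E"
        have "AE x in lebesgue. x \<in> dom_int E \<longrightarrow> F r x = G r x"
          unfolding Suc
        proof (rule step)
          show "q < ord_of E" using r Suc by simp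
          show "\<forall>s\<le>q. \<forall>x\<in>dom_int E. F s x = G s x"
          proof (intro allI impI)
            fix s assume "s \<le> q"
            then have "s < r" "s < ord_of E" using r Suc by simp_all
            then show "\<forall>x\<in>dom_int E. F s x = G s x" using less.IH by blast
          qed
        qed
        moreover have "continuous_on (dom_int E) (F r)" "continuous_on (dom_int E) (G r)"
          using F G r opn ac_loc_continuous_on by (auto simp: derivs_of_def)
        ultimately show "F r x = G r x"
          using continuous_AE_eq_imp_eq opn x by blast
      qed
    qed
  qed
  then show "r < ord_of E \<Longrightarrow> \<forall>x\<in>dom_int E. F r x = G r x" by blast
  obtain q where q: "ord_of E = Suc q"
    using reg by (cases "ord_of E") (auto simp: ord_of_def regular_expr_def)
  show "ae_eq E (F (ord_of E)) (G (ord_of E))"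
    unfolding ae_eq_def q
  proof (rule step)
    show "q < ord_of E" using q by simp
    show "\<forall>s\<le>q. \<forall>x\<in>dom_int E. F s x = G s x"
    proof (intro allI impI)
      fix s assume "s \<le> q"
      then have "s < ord_of E" using q by simp
      then show "\<forall>x\<in>dom_int E. F s x = G s x" using main by blast
    qed
  qed
qed

lemma ell_AE_unique:
  assumes "regular_expr E" "derivs_of E f F"
  shows "ae_eq E (ell E f) (F (ord_of E))"
proof -
  have "\<exists>h G. derivs_of E f G \<and> h = G (ord_of E)"
    using assms(2) by blast
  then have "\<exists>G. derivs_of E f G \<and> ell E f = G (ord_of E)"
    unfolding ell_def by (rule someI_ex)
  then obtain G where G: "derivs_of E f G" "ell E f = G (ord_of E)"
    by blast
  show ?thesis
    unfolding G(2) by (rule derivs_of_unique(2)[OF assms(1) G(1) assms(2)])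
qed

end

theory Submission
  imports Defs
begin

text \<open>The self-adjoint operator \<open>T = {\<ell>, D\<^sub>L}\<close> splits the maximal domain: \<open>T - \<i>\<close> maps \<open>D\<^sub>L\<close> onto the
  whole Hilbert space, since its range is closed and contains the complete set of eigenfunctions, whose
  eigenvalues are real. For \<open>f\<close> in the maximal domain let \<open>g\<close> in \<open>D\<^sub>L\<close> solve
  \<open>(T - \<i>) g = (\<ell> - \<i>) f\<close>. Then \<open>f - g\<close> is in \<open>D\<^sub>+\<close>, and so \<open>D\<^sub>m\<^sub>a\<^sub>x = D\<^sub>+ + D\<^sub>L\<close>
  (lemma \<open>Dmax_eq_self_adjoint_plus_Dplus\<close>).

  The sesquilinear form vanishes on \<open>D\<^sub>L\<close>, because \<open>T\<close> is symmetric. Hence an element of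
  \<open>D\<^sub>L\<close> that pairs to zero with \<open>D\<^sub>+\<close> pairs to zero with everything, i.e. lies in \<open>D\<^sub>m\<^sub>i\<^sub>n\<close>. Since \<open>D\<^sub>+\<close> has dimension \<open>m\<close>, the \<open>m\<close> eigenfunctions, being
  independent modulo \<open>D\<^sub>m\<^sub>i\<^sub>n\<close>, form with a basis of \<open>D\<^sub>+\<close> a square matrix without left kernel, hence
  without right kernel: an element of \<open>D\<^sub>+\<close> that pairs to zero with the \<open>m\<close> eigenfunctions is zero
  (lemma \<open>isotropic_independent_imp_GKN\<close>). So the GKN conditions imposed on \<open>f = h + g\<close>, with \<open>h\<close> in
  \<open>D\<^sub>+\<close> and \<open>g\<close> in \<open>D\<^sub>L\<close>, say exactly that \<open>h = 0\<close>.

  The closed range rests on the completeness of the weighted space, which is derived from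
  \<open>geometric_Cauchy_square_integrable_limit\<close> by viewing it as an \<open>L\<^sup>2\<close> space for a measure with
  density.\<close>

section \<open>Square systems of linear equations\<close>

text \<open>Gaussian elimination, as an induction on the set of equations: an unknown \<open>p\<close> that occurs in
  equation \<open>j\<close> is eliminated from the others with the help of \<open>j\<close>.\<close>

lemma homogeneous_system_nontrivial_solution:
  fixes a :: "'i \<Rightarrow> 'j \<Rightarrow> 'k :: field"
  assumes "finite J" "finite I" "card J < card I"
  shows "\<exists>c. (\<exists>i\<in>I. c i \<noteq> 0) \<and> (\<forall>j\<in>J. (\<Sum>i\<in>I. c i * a i j) = 0)"
  using assms
proof (induction J arbitrary: I a rule: finite_induct)
  case empty
  then obtain i where "i \<in> I" by fastforce
  then show ?case by (intro exI[of _ "\<lambda>_. 1"]) auto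
next
  case (insert j J)
  show ?case
  proof (cases "\<forall>i\<in>I. a i j = 0")
    case True
    have "card J < card I" using insert by simp
    from insert.IH[OF insert.prems(1) this, of a] True show ?thesis by auto
  next
    case False
    then obtain p where p: "p \<in> I" "a p j \<noteq> 0" by blast
    define a' where "a' = (\<lambda>i k. a i k - a i j / a p j * a p k)"
    have "finite (I - {p})" "card J < card (I - {p})"
      using insert p by (auto simp: card_Diff_singleton)
    from insert.IH[OF this, of a'] obtain c where
      nz: "\<exists>i\<in>I - {p}. c i \<noteq> 0" and c: "\<forall>k\<in>J. (\<Sum>i\<in>I - {p}. c i * a' i k) = 0"
      by blast
    define cp where "cp = - (\<Sum>i\<in>I - {p}. c i * a i j) / a p j"
    have sum_eq: "(\<Sum>i\<in>I. (c(p := cp)) i * a i k) = cp * a p k + (\<Sum>i\<in>I - {p}. c i * a i k)" for k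
      using p(1) insert.prems(1) by (subst sum.remove[of _ p]) (auto intro!: sum.cong)
    have "(\<Sum>i\<in>I. (c(p := cp)) i * a i j) = 0"
      using p(2) unfolding sum_eq by (simp add: cp_def)
    moreover have "(\<Sum>i\<in>I. (c(p := cp)) i * a i k) = 0" if "k \<in> J" for k
    proof -
      have "0 = (\<Sum>i\<in>I - {p}. c i * a i k - (c i * a i j) * (a p k / a p j))"
        using c that by (simp add: a'_def algebra_simps)
      also have "\<dots> = (\<Sum>i\<in>I - {p}. c i * a i k) - (\<Sum>i\<in>I - {p}. c i * a i j) * (a p k / a p j)"
        by (simp only: sum_subtractf sum_distrib_right)
      finally show ?thesis unfolding sum_eq by (simp add: cp_def field_simps)
    qed
    ultimately show ?thesis using nz by (intro exI[of _ "c(p := cp)"]) auto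
  qed
qed

text \<open>Row rank equals column rank, in the form of a trivial kernel on one side forcing a trivial kernel
  on the other. If \<open>d\<close> is in the right kernel and \<open>d q \<noteq> 0\<close>, then equation \<open>q\<close> is a
  combination of the remaining ones, which are fewer than the unknowns.\<close>

lemma square_system_left_inj_imp_right_inj:
  fixes A :: "'i \<Rightarrow> 'j \<Rightarrow> 'k :: field"
  assumes fin: "finite I" "finite J" and card: "card I = card J"
    and left: "\<And>c. \<forall>j\<in>J. (\<Sum>i\<in>I. c i * A i j) = 0 \<Longrightarrow> \<forall>i\<in>I. c i = 0"
    and right: "\<forall>i\<in>I. (\<Sum>j\<in>J. A i j * d j) = 0"
  shows "\<forall>j\<in>J. d j = 0"
proof (rule ccontr)
  assume "\<not> ?thesis"
  then obtain q where q: "q \<in> J" "d q \<noteq> 0" by blast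
  have "card (J - {q}) < card I"
    unfolding card by (rule card_Diff1_less[OF fin(2) q(1)])
  from homogeneous_system_nontrivial_solution[OF finite_Diff[OF fin(2)] fin(1) this, of A]
  obtain c where nz: "\<exists>i\<in>I. c i \<noteq> 0" and c: "\<forall>j\<in>J - {q}. (\<Sum>i\<in>I. c i * A i j) = 0"
    by blast
  have "0 = (\<Sum>i\<in>I. c i * (\<Sum>j\<in>J. A i j * d j))" using right by simp
  also have "\<dots> = (\<Sum>j\<in>J. (\<Sum>i\<in>I. c i * A i j) * d j)"
    by (simp add: sum_distrib_left sum_distrib_right mult.assoc) (rule sum.swap)
  also have "\<dots> = (\<Sum>i\<in>I. c i * A i q) * d q"
    using c q(1) fin(2) by (subst sum.remove[of _ q]) auto
  finally have "(\<Sum>i\<in>I. c i * A i q) = 0" using q(2) by simp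
  with c have "\<forall>j\<in>J. (\<Sum>i\<in>I. c i * A i j) = 0" by blast
  from left[OF this] nz show False by blast
qed

section \<open>Square-integrable functions\<close>

definition square_integrable :: "'a measure \<Rightarrow> ('a \<Rightarrow> complex) \<Rightarrow> bool" where
  "square_integrable M u \<longleftrightarrow> u \<in> borel_measurable M \<and> integrable M (\<lambda>x. (norm (u x))\<^sup>2)"

lemma norm_add_sq_le: "(norm (a + b :: 'a :: real_normed_vector))\<^sup>2 \<le> 2 * (norm a)\<^sup>2 + 2 * (norm b)\<^sup>2"
proof -
  have "(norm (a + b))\<^sup>2 \<le> (norm a + norm b)\<^sup>2"
    by (intro power_mono norm_triangle_ineq) auto
  moreover have "0 \<le> (norm a - norm b)\<^sup>2" by simp
  ultimately show ?thesis unfolding power2_sum power2_diff by linarith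
qed

lemma norm_diff_sq_le: "(norm (a - b :: 'a :: real_normed_vector))\<^sup>2 \<le> 2 * (norm a)\<^sup>2 + 2 * (norm b)\<^sup>2"
  using norm_add_sq_le[of a "- b"] by simp

lemma square_integrable_add:
  assumes "square_integrable M u" "square_integrable M v"
  shows "square_integrable M (\<lambda>x. u x + v x)"
proof -
  have [measurable]: "u \<in> borel_measurable M" "v \<in> borel_measurable M"
    using assms by (auto simp: square_integrable_def)
  have "integrable M (\<lambda>x. (norm (u x + v x))\<^sup>2)"
    by (rule Bochner_Integration.integrable_bound[of M "\<lambda>x. 2 * (norm (u x))\<^sup>2 + 2 * (norm (v x))\<^sup>2"])
      (use assms in \<open>auto simp: square_integrable_def norm_add_sq_le\<close>)
  then show ?thesis by (simp add: square_integrable_def)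
qed

lemma square_integrable_scale:
  assumes "square_integrable M u" shows "square_integrable M (\<lambda>x. c * u x)"
  using assms by (auto simp: square_integrable_def norm_mult power_mult_distrib)

lemma square_integrable_diff:
  assumes "square_integrable M u" "square_integrable M v"
  shows "square_integrable M (\<lambda>x. u x - v x)"
  using square_integrable_add[OF assms(1) square_integrable_scale[OF assms(2), of "-1"]] by simp

lemma square_integrable_mult_integrable:
  assumes "square_integrable M u" "square_integrable M v"
  shows "integrable M (\<lambda>x. u x * cnj (v x))"
proof (rule Bochner_Integration.integrable_bound[of M "\<lambda>x. (norm (u x))\<^sup>2 + (norm (v x))\<^sup>2"])
  have [measurable]: "u \<in> borel_measurable M" "v \<in> borel_measurable M"
    using assms by (auto simp: square_integrable_def)
  have [measurable]: "cnj \<in> borel_measurable borel"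
    by (intro borel_measurable_continuous_onI continuous_intros)
  show "(\<lambda>x. u x * cnj (v x)) \<in> borel_measurable M" by measurable
  show "integrable M (\<lambda>x. (norm (u x))\<^sup>2 + (norm (v x))\<^sup>2)"
    using assms by (auto simp: square_integrable_def)
  show "AE x in M. norm (u x * cnj (v x)) \<le> norm ((norm (u x))\<^sup>2 + (norm (v x))\<^sup>2)"
  proof (rule AE_I2)
    fix x
    have "0 \<le> (norm (u x) - norm (v x))\<^sup>2" "0 \<le> norm (u x) * norm (v x)" by simp_all
    then have "norm (u x) * norm (v x) \<le> (norm (u x))\<^sup>2 + (norm (v x))\<^sup>2"
      unfolding power2_diff mult.assoc by linarith
    then show "norm (u x * cnj (v x)) \<le> norm ((norm (u x))\<^sup>2 + (norm (v x))\<^sup>2)"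
      by (simp add: norm_mult)
  qed
qed

lemma Cauchy_Schwarz_square_integrable:
  assumes "square_integrable M u" "square_integrable M v"
  shows "(norm (LINT x|M. u x * cnj (v x)))\<^sup>2
      \<le> (LINT x|M. (norm (u x))\<^sup>2) * (LINT x|M. (norm (v x))\<^sup>2)"
proof -
  have [measurable]: "u \<in> borel_measurable M" "v \<in> borel_measurable M"
    and int: "integrable M (\<lambda>x. (norm (u x))\<^sup>2)" "integrable M (\<lambda>x. (norm (v x))\<^sup>2)"
    using assms by (auto simp: square_integrable_def)
  have intuv: "integrable M (\<lambda>x. norm (u x) * norm (v x))"
    using integrable_norm[OF square_integrable_mult_integrable[OF assms]] by (simp add: norm_mult)
  have "ennreal ((LINT x|M. norm (u x) * norm (v x))\<^sup>2)
      = (\<integral>\<^sup>+x. ennreal (norm (u x)) * ennreal (norm (v x)) \<partial>M)\<^sup>2"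
    using nn_integral_eq_integral[OF intuv] by (simp add: ennreal_mult ennreal_power)
  also have "\<dots> \<le> (\<integral>\<^sup>+x. (ennreal (norm (u x)))\<^sup>2 \<partial>M) * (\<integral>\<^sup>+x. (ennreal (norm (v x)))\<^sup>2 \<partial>M)"
    by (rule Cauchy_Schwarz_nn_integral) measurable
  also have "\<dots> = ennreal ((LINT x|M. (norm (u x))\<^sup>2) * (LINT x|M. (norm (v x))\<^sup>2))"
    using nn_integral_eq_integral[OF int(1)] nn_integral_eq_integral[OF int(2)]
    by (simp add: ennreal_mult ennreal_power)
  finally have "(LINT x|M. norm (u x) * norm (v x))\<^sup>2
      \<le> (LINT x|M. (norm (u x))\<^sup>2) * (LINT x|M. (norm (v x))\<^sup>2)"
    by (simp add: ennreal_le_iff)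
  moreover have "norm (LINT x|M. u x * cnj (v x)) \<le> (LINT x|M. norm (u x) * norm (v x))"
    using integral_norm_bound[of M "\<lambda>x. u x * cnj (v x)"] by (simp add: norm_mult)
  ultimately show ?thesis
    by (meson norm_ge_zero order_trans power_mono)
qed

text \<open>The completeness of \<open>L\<^sup>2\<close>, for sequences whose increments decay geometrically, so that no
  subsequence has to be extracted: the increments are summable almost everywhere, and Fatou's lemma
  carries the bound over to the pointwise limit.\<close>

lemma geometric_Cauchy_square_integrable_limit:
  assumes u: "\<And>n. square_integrable M (u n)"
    and C: "\<And>n m. n \<le> m \<Longrightarrow> (LINT x|M. (norm (u n x - u m x))\<^sup>2) \<le> C / 4 ^ n"
  obtains v where "square_integrable M v"
    "\<And>n. (LINT x|M. (norm (u n x - v x))\<^sup>2) \<le> C / 4 ^ n"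
proof -
  have [measurable]: "\<And>n. u n \<in> borel_measurable M"
    using u by (auto simp: square_integrable_def)
  have C0: "C \<ge> 0" using C[of 0 0] by simp
  have intd: "integrable M (\<lambda>x. (norm (u n x - u m x))\<^sup>2)" for n m
    using square_integrable_diff[OF u u, of n m] by (simp add: square_integrable_def)
  have "(\<integral>\<^sup>+x. (\<Sum>n. ennreal (2 ^ n * (norm (u n x - u (Suc n) x))\<^sup>2)) \<partial>M)
      = (\<Sum>n. \<integral>\<^sup>+x. ennreal (2 ^ n * (norm (u n x - u (Suc n) x))\<^sup>2) \<partial>M)"
    by (rule nn_integral_suminf) measurable
  also have "\<dots> \<le> (\<Sum>n. ennreal (C * (1/2) ^ n))"
  proof (intro suminf_le summableI allI)
    fix n
    have "(\<integral>\<^sup>+x. ennreal (2 ^ n * (norm (u n x - u (Suc n) x))\<^sup>2) \<partial>M)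
        = ennreal (LINT x|M. 2 ^ n * (norm (u n x - u (Suc n) x))\<^sup>2)"
      by (rule nn_integral_eq_integral) (auto intro: intd)
    also have "\<dots> \<le> ennreal (2 ^ n * (C / 4 ^ n))"
      using mult_left_mono[OF C[of n "Suc n"], of "2 ^ n"] by (intro ennreal_leI) simp
    also have "2 ^ n * (C / 4 ^ n) = C * (1/2) ^ n"
      using power_mult_distrib[of "2::real" 2 n] by (simp add: field_simps)
    finally show "(\<integral>\<^sup>+x. ennreal (2 ^ n * (norm (u n x - u (Suc n) x))\<^sup>2) \<partial>M)
        \<le> ennreal (C * (1/2) ^ n)" .
  qed
  also have "\<dots> = ennreal (\<Sum>n. C * (1/2) ^ n)"
    using C0 by (intro suminf_ennreal2) (auto intro: summable_mult)
  finally have "(\<integral>\<^sup>+x. (\<Sum>n. ennreal (2 ^ n * (norm (u n x - u (Suc n) x))\<^sup>2)) \<partial>M) \<noteq> \<infinity>"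
    unfolding infinity_ennreal_def by (rule neq_top_trans[OF ennreal_neq_top])
  then have "AE x in M. (\<Sum>n. ennreal (2 ^ n * (norm (u n x - u (Suc n) x))\<^sup>2)) \<noteq> \<infinity>"
    by (intro nn_integral_PInf_AE) measurable
  then have conv: "AE x in M. convergent (\<lambda>n. u n x)"
  proof eventually_elim
    case (elim x)
    have "summable (\<lambda>n. 2 ^ n * (norm (u n x - u (Suc n) x))\<^sup>2)"
      by (rule summable_suminf_not_top) (use elim in auto)
    then have "summable (\<lambda>n. 2 ^ n * (norm (u n x - u (Suc n) x))\<^sup>2 + (1/2) ^ n)"
      by (intro summable_add) auto
    then have "summable (\<lambda>n. u (Suc n) x - u n x)"
    proof (rule summable_comparison_test'[where N = 0])
      fix n
      \<comment> \<open>the arithmetic-geometric mean inequality for the factors \<open>2 ^ n * d\<^sup>2\<close> and \<open>2 ^ -n\<close>\<close>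
      let ?d = "norm (u n x - u (Suc n) x)"
      have "0 \<le> 2 ^ n * (?d - (1/2) ^ n)\<^sup>2" by simp
      also have "\<dots> = 2 ^ n * ?d\<^sup>2 + (1/2) ^ n - 2 * ?d"
        by (simp add: power2_diff algebra_simps power2_eq_square power_one_over)
      finally have "2 * ?d \<le> 2 ^ n * ?d\<^sup>2 + (1/2) ^ n" by simp
      moreover have "0 \<le> ?d" by simp
      ultimately have "?d \<le> 2 ^ n * ?d\<^sup>2 + (1/2) ^ n" by linarith
      then show "norm (u (Suc n) x - u n x) \<le> 2 ^ n * ?d\<^sup>2 + (1/2) ^ n"
        by (simp add: norm_minus_commute)
    qed
    then have "convergent (\<lambda>n. \<Sum>i<n. u (Suc i) x - u i x)"
      by (simp add: summable_iff_convergent)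
    then have "convergent (\<lambda>n. u n x - u 0 x)"
      unfolding sum_lessThan_telescope[of "\<lambda>i. u i x"] .
    then show ?case
      using convergent_add[OF _ convergent_const[of "u 0 x"], of "\<lambda>n. u n x - u 0 x"] by simp
  qed
  define v where "v = (\<lambda>x. lim (\<lambda>n. u n x))"
  have [measurable]: "v \<in> borel_measurable M" unfolding v_def by measurable
  have fatou: "(\<integral>\<^sup>+x. ennreal ((norm (u n x - v x))\<^sup>2) \<partial>M) \<le> ennreal (C / 4 ^ n)" for n
  proof -
    have "(\<integral>\<^sup>+x. ennreal ((norm (u n x - v x))\<^sup>2) \<partial>M)
        \<le> (\<integral>\<^sup>+x. liminf (\<lambda>m. ennreal ((norm (u n x - u m x))\<^sup>2)) \<partial>M)"
    proof (rule nn_integral_mono_AE)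
      show "AE x in M. ennreal ((norm (u n x - v x))\<^sup>2)
          \<le> liminf (\<lambda>m. ennreal ((norm (u n x - u m x))\<^sup>2))"
        using conv
      proof eventually_elim
        case (elim x)
        then have "(\<lambda>m. u m x) \<longlonglongrightarrow> v x"
          by (simp add: v_def convergent_LIMSEQ_iff)
        then have "(\<lambda>m. ennreal ((norm (u n x - u m x))\<^sup>2)) \<longlonglongrightarrow> ennreal ((norm (u n x - v x))\<^sup>2)"
          by (intro tendsto_intros)
        from lim_imp_Liminf[OF sequentially_bot this] show ?case by simp
      qed
    qed
    also have "\<dots> \<le> liminf (\<lambda>m. \<integral>\<^sup>+x. ennreal ((norm (u n x - u m x))\<^sup>2) \<partial>M)"
      by (rule nn_integral_liminf) measurable
    also have "\<dots> \<le> liminf (\<lambda>m. ennreal (C / 4 ^ n))"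
    proof (intro Liminf_mono eventually_sequentiallyI[of n])
      fix m assume "n \<le> m"
      then show "(\<integral>\<^sup>+x. ennreal ((norm (u n x - u m x))\<^sup>2) \<partial>M) \<le> ennreal (C / 4 ^ n)"
        using C[of n m] nn_integral_eq_integral[OF intd] by (simp add: ennreal_leI)
    qed
    finally show ?thesis by (simp add: Liminf_const)
  qed
  have int: "integrable M (\<lambda>x. (norm (u n x - v x))\<^sup>2)" for n
    by (rule integrableI_bounded) (use fatou[of n] in \<open>auto simp: le_less_trans[OF _ ennreal_less_top]\<close>)
  show ?thesis
  proof (rule that)
    have "square_integrable M (\<lambda>x. u 0 x - (u 0 x - v x))"
      by (rule square_integrable_diff[OF u]) (use int[of 0] in \<open>auto simp: square_integrable_def\<close>)
    then show "square_integrable M v" by simp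
    show "(LINT x|M. (norm (u n x - v x))\<^sup>2) \<le> C / 4 ^ n" for n
      using fatou[of n] C0 nn_integral_eq_integral[OF int[of n]] by (simp add: ennreal_le_iff)
  qed
qed

section \<open>The weighted space as a space of square-integrable functions\<close>

text \<open>The inner product of the weighted space is the one of \<open>L\<^sup>2\<close> for this measure. The indicator is
  part of the density because the weight is positive and measurable on the interval only.\<close>

definition weight_measure :: "diff_expr \<Rightarrow> real measure" where
  "weight_measure E = density lebesgue (\<lambda>x. ennreal (indicator (dom_int E) x * weight E x))"

text \<open>An element of the weighted space is arbitrary, possibly not measurable, off the interval. Only after
  this truncation is it an element of an \<open>L\<^sup>2\<close> space over the whole line.\<close>

definition cut :: "diff_expr \<Rightarrow> (real \<Rightarrow> complex) \<Rightarrow> real \<Rightarrow> complex" where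
  "cut E f = (\<lambda>x. indicator (dom_int E) x *\<^sub>R f x)"

lemma open_dom_int: "open (dom_int E)"
  by (simp add: dom_int_def)

lemma dom_int_sets [measurable]: "dom_int E \<in> sets lebesgue"
  by (intro sets_completionI_sets) (simp add: open_dom_int borel_open)

text \<open>Local integrability controls the function on compact subintervals only; countably many of them, with
  rational end points, exhaust the open set.\<close>

lemma L1_loc_measurable:
  assumes I: "open I" and u: "L1_loc I u"
  shows "(\<lambda>x. indicator I x * u x) \<in> borel_measurable lebesgue"
proof -
  define \<K> where "\<K> = {{c..d} | c d. c \<in> \<rat> \<and> d \<in> \<rat> \<and> c < d \<and> {c..d} \<subseteq> I}"
  have "\<K> \<subseteq> (\<lambda>(c, d). {c..d}) ` (\<rat> \<times> \<rat>)" by (auto simp: \<K>_def)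
  then have "countable \<K>"
    by (rule countable_subset) (intro countable_image countable_SIGMA countable_rat)
  show ?thesis
  proof (rule measurable_piecewise_restrict)
    show "countable (insert (- I) \<K>)" using \<open>countable \<K>\<close> by simp
    show "\<Omega> \<inter> space lebesgue \<in> sets lebesgue" if "\<Omega> \<in> insert (- I) \<K>" for \<Omega>
      using that I by (auto simp: \<K>_def)
    show "space lebesgue \<subseteq> \<Union> (insert (- I) \<K>)"
    proof
      fix x :: real
      show "x \<in> \<Union> (insert (- I) \<K>)"
      proof (cases "x \<in> I")
        case True
        then obtain e where e: "e > 0" "cball x e \<subseteq> I"
          using I open_contains_cball by blast
        obtain c d where "c \<in> \<rat>" "x - e < c" "c < x" "d \<in> \<rat>" "x < d" "d < x + e"
          using Rats_dense_in_real[of "x - e" x] Rats_dense_in_real[of x "x + e"] e(1) by auto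
        then have "{c..d} \<in> \<K>" "x \<in> {c..d}"
          using e(2) by (fastforce simp: \<K>_def cball_eq_atLeastAtMost)+
        then show ?thesis by blast
      qed simp
    qed
    show "(\<lambda>x. indicator I x * u x) \<in> borel_measurable (restrict_space lebesgue \<Omega>)"
      if \<Omega>: "\<Omega> \<in> insert (- I) \<K>" for \<Omega>
    proof (cases "\<Omega> = - I")
      case True
      then show ?thesis
        by (subst measurable_cong[where g = "\<lambda>x. 0"]) (auto simp: space_restrict_space)
    next
      case False
      then obtain c d where cd: "\<Omega> = {c..d}" "c < d" "{c..d} \<subseteq> I"
        using \<Omega> by (auto simp: \<K>_def)
      then have "(\<lambda>x. indicator {c..d} x * u x) \<in> borel_measurable lebesgue"
        using u by (auto simp: L1_loc_def set_integrable_def dest: borel_measurable_integrable)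
      then have *: "(\<lambda>x. indicator {c..d} x * u x) \<in> borel_measurable (restrict_space lebesgue \<Omega>)"
        by (rule measurable_restrict_space1)
      show ?thesis
        by (rule measurable_cong[THEN iffD2, OF _ *])
          (use cd in \<open>auto simp: space_restrict_space indicator_def\<close>)
    qed
  qed
qed

lemma weight_density_measurable:
  assumes "regular_expr E"
  shows "(\<lambda>x. indicator (dom_int E) x * weight E x) \<in> borel_measurable lebesgue"
  using assms L1_loc_measurable[OF open_dom_int] by (auto simp: regular_expr_def)

lemma weight_density_nonneg:
  assumes "regular_expr E"
  shows "AE x in lebesgue. 0 \<le> indicator (dom_int E) x * weight E x"
proof -
  have "AE x in lebesgue. x \<in> dom_int E \<longrightarrow> weight E x > 0"
    using assms by (auto simp: regular_expr_def)
  then show ?thesis by eventually_elim (auto simp: indicator_def)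
qed

lemma sets_weight_measure [measurable_cong]: "sets (weight_measure E) = sets lebesgue"
  by (simp add: weight_measure_def)

lemma L2w_iff:
  assumes "regular_expr E"
  shows "f \<in> L2w E \<longleftrightarrow> square_integrable (weight_measure E) (cut E f)"
proof -
  have *: "integrable (weight_measure E) (\<lambda>x. (norm (cut E f x))\<^sup>2) \<longleftrightarrow>
      set_integrable lebesgue (dom_int E) (\<lambda>x. (norm (f x))\<^sup>2 * weight E x)"
    if [measurable]: "cut E f \<in> borel_measurable lebesgue"
  proof -
    have eq: "(\<lambda>x. (indicator (dom_int E) x * weight E x) *\<^sub>R (norm (cut E f x))\<^sup>2)
        = (\<lambda>x. indicator (dom_int E) x *\<^sub>R ((norm (f x))\<^sup>2 * weight E x))"
      by (auto simp: fun_eq_iff cut_def indicator_def)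
    have "(\<lambda>x. (norm (cut E f x))\<^sup>2) \<in> borel_measurable lebesgue" by measurable
    from integrable_density[OF this weight_density_measurable[OF assms] weight_density_nonneg[OF assms]]
    show ?thesis unfolding eq weight_measure_def set_integrable_def .
  qed
  have [simp]: "borel_measurable (weight_measure E) = (borel_measurable lebesgue :: (real \<Rightarrow> complex) set)"
    by (rule measurable_cong_sets) (simp_all add: sets_weight_measure)
  show ?thesis
    using * by (auto simp: L2w_def square_integrable_def set_borel_measurable_def cut_def)
qed

lemma ip_eq_integral:
  assumes reg: "regular_expr E" and "f \<in> L2w E" "g \<in> L2w E"
  shows "ip E f g = (LINT x|weight_measure E. cut E f x * cnj (cut E g x))"
proof -
  have "(\<lambda>x. cut E f x * cnj (cut E g x)) \<in> borel_measurable (weight_measure E)"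
    using assms unfolding L2w_iff[OF reg]
    by (intro borel_measurable_integrable square_integrable_mult_integrable)
  then have "(\<lambda>x. cut E f x * cnj (cut E g x)) \<in> borel_measurable lebesgue"
    using measurable_cong_sets[OF sets_weight_measure refl] by blast
  from integral_density[OF this weight_density_measurable[OF reg] weight_density_nonneg[OF reg]]
  show ?thesis
    unfolding ip_def weight_measure_def set_lebesgue_integral_def
    by (auto intro!: Bochner_Integration.integral_cong simp: cut_def indicator_def scaleR_conv_of_real)
qed

lemma L2norm_eq_integral:
  assumes reg: "regular_expr E" and "f \<in> L2w E"
  shows "L2norm E f = sqrt (LINT x|weight_measure E. (norm (cut E f x))\<^sup>2)"
proof -
  have "(\<lambda>x. (norm (cut E f x))\<^sup>2) \<in> borel_measurable (weight_measure E)"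
    using assms by (auto simp: L2w_iff[OF reg] square_integrable_def)
  then have "(\<lambda>x. (norm (cut E f x))\<^sup>2) \<in> borel_measurable lebesgue"
    using measurable_cong_sets[OF sets_weight_measure refl] by blast
  from integral_density[OF this weight_density_measurable[OF reg] weight_density_nonneg[OF reg]]
  have "(LINT x|weight_measure E. (norm (cut E f x))\<^sup>2)
      = (LINT x:dom_int E|lebesgue. (norm (f x))\<^sup>2 * weight E x)"
    unfolding weight_measure_def set_lebesgue_integral_def
    by (auto intro!: Bochner_Integration.integral_cong simp: cut_def indicator_def)
  then show ?thesis unfolding L2norm_def by simp
qed

lemma L2norm_nonneg:
  assumes "regular_expr E" "f \<in> L2w E" shows "0 \<le> L2norm E f"
  by (simp add: L2norm_eq_integral[OF assms])

lemma L2norm_sq_eq_integral: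
  assumes "regular_expr E" "f \<in> L2w E"
  shows "(L2norm E f)\<^sup>2 = (LINT x|weight_measure E. (norm (cut E f x))\<^sup>2)"
  by (simp add: L2norm_eq_integral[OF assms])

lemma cut_add: "cut E (\<lambda>x. f x + g x) = (\<lambda>x. cut E f x + cut E g x)"
  by (simp add: cut_def scaleR_add_right)

lemma cut_scale: "cut E (\<lambda>x. c * f x) = (\<lambda>x. c * cut E f x)"
  by (simp add: cut_def)

lemma cut_diff: "cut E (\<lambda>x. f x - g x) = (\<lambda>x. cut E f x - cut E g x)"
  by (simp add: cut_def scaleR_diff_right)

lemma L2w_add:
  assumes "regular_expr E" "f \<in> L2w E" "g \<in> L2w E" shows "(\<lambda>x. f x + g x) \<in> L2w E"
  using assms by (simp add: L2w_iff cut_add square_integrable_add)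

lemma L2w_scale:
  assumes "regular_expr E" "f \<in> L2w E" shows "(\<lambda>x. c * f x) \<in> L2w E"
  using assms by (simp add: L2w_iff cut_scale square_integrable_scale)

lemma L2w_diff:
  assumes "regular_expr E" "f \<in> L2w E" "g \<in> L2w E" shows "(\<lambda>x. f x - g x) \<in> L2w E"
  using assms by (simp add: L2w_iff cut_diff square_integrable_diff)

lemma ip_cnj: "cnj (ip E f g) = ip E g f"
proof -
  have "ip E g f = (CLINT x|lebesgue. cnj (indicator (dom_int E) x *\<^sub>R
      (f x * cnj (g x) * complex_of_real (weight E x))))"
    unfolding ip_def set_lebesgue_integral_def
    by (rule Bochner_Integration.integral_cong) (simp_all add: mult_ac)
  then show ?thesis
    unfolding ip_def set_lebesgue_integral_def by (simp del: complex_cnj_scaleR)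
qed

lemma ip_add_left:
  assumes reg: "regular_expr E" and "f \<in> L2w E" "g \<in> L2w E" "h \<in> L2w E"
  shows "ip E (\<lambda>x. f x + g x) h = ip E f h + ip E g h"
  using assms
  by (simp add: ip_eq_integral L2w_add cut_add distrib_right L2w_iff square_integrable_mult_integrable)

lemma ip_scale_left: "ip E (\<lambda>x. c * f x) h = c * ip E f h"
  unfolding ip_def set_lebesgue_integral_def
  by (subst integral_mult_right_zero[symmetric]) (simp add: mult_ac)

lemma ip_diff_left:
  assumes reg: "regular_expr E" and "f \<in> L2w E" "g \<in> L2w E" "h \<in> L2w E"
  shows "ip E (\<lambda>x. f x - g x) h = ip E f h - ip E g h"
  using ip_add_left[OF reg assms(2) L2w_scale[OF reg assms(3), of "-1"] assms(4)]
    ip_scale_left[of E "-1" g h] by simp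

lemma ip_add_right:
  assumes "regular_expr E" "f \<in> L2w E" "g \<in> L2w E" "h \<in> L2w E"
  shows "ip E h (\<lambda>x. f x + g x) = ip E h f + ip E h g"
  using ip_add_left[OF assms] by (metis complex_cnj_add ip_cnj)

lemma ip_scale_right: "ip E h (\<lambda>x. c * f x) = cnj c * ip E h f"
  using ip_scale_left[of E c f h] by (metis complex_cnj_mult ip_cnj)

lemma ip_diff_right:
  assumes "regular_expr E" "f \<in> L2w E" "g \<in> L2w E" "h \<in> L2w E"
  shows "ip E h (\<lambda>x. f x - g x) = ip E h f - ip E h g"
  using ip_diff_left[OF assms] by (metis complex_cnj_diff ip_cnj)

lemma ip_cong_AE:
  assumes reg: "regular_expr E" and "ae_eq E f f'"
    "f \<in> L2w E" "f' \<in> L2w E" "g \<in> L2w E"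
  shows "ip E f g = ip E f' g"
proof -
  have meas: "(\<lambda>x. cut E u x * cnj (cut E g x)) \<in> borel_measurable (weight_measure E)"
    if "u \<in> L2w E" for u
    using that assms unfolding L2w_iff[OF reg]
    by (intro borel_measurable_integrable square_integrable_mult_integrable)
  have "AE x in lebesgue. x \<in> dom_int E \<longrightarrow> f x = f' x"
    using assms(2) by (simp add: ae_eq_def)
  then have "AE x in lebesgue. cut E f x * cnj (cut E g x) = cut E f' x * cnj (cut E g x)"
    by eventually_elim (auto simp: cut_def indicator_def)
  then have "AE x in weight_measure E. cut E f x * cnj (cut E g x) = cut E f' x * cnj (cut E g x)"
    unfolding weight_measure_def using weight_density_measurable[OF reg]
    by (subst AE_density) auto
  then show ?thesis
    unfolding ip_eq_integral[OF reg assms(3,5)] ip_eq_integral[OF reg assms(4,5)]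
    by (intro integral_cong_AE meas assms)
qed

lemma ip_cong_AE_right:
  assumes "regular_expr E" "ae_eq E f f'" "f \<in> L2w E" "f' \<in> L2w E" "g \<in> L2w E"
  shows "ip E g f = ip E g f'"
  using ip_cong_AE[OF assms] by (metis ip_cnj)

lemma ip_self:
  assumes "regular_expr E" "f \<in> L2w E"
  shows "ip E f f = complex_of_real ((L2norm E f)\<^sup>2)"
  using assms by (simp add: ip_eq_integral L2norm_sq_eq_integral complex_norm_square[symmetric]
      flip: integral_complex_of_real)


text \<open>Positivity of the weight almost everywhere is what makes the null sets of the weighted space those of
  Lebesgue measure on the interval.\<close>

lemma ae_eq_zero_iff_L2norm:
  assumes reg: "regular_expr E" and f: "f \<in> L2w E"
  shows "L2norm E f = 0 \<longleftrightarrow> ae_eq E f (\<lambda>x. 0)"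
proof -
  have w: "AE x in lebesgue. x \<in> dom_int E \<longrightarrow> weight E x > 0"
    using reg by (auto simp: regular_expr_def)
  have int: "integrable (weight_measure E) (\<lambda>x. (norm (cut E f x))\<^sup>2)"
    using f by (simp add: L2w_iff[OF reg] square_integrable_def)
  have "L2norm E f = 0 \<longleftrightarrow> (L2norm E f)\<^sup>2 = 0" by simp
  also have "\<dots> \<longleftrightarrow> (AE x in weight_measure E. (norm (cut E f x))\<^sup>2 = 0)"
    unfolding L2norm_sq_eq_integral[OF assms]
    by (rule integral_nonneg_eq_0_iff_AE[OF int]) simp
  also have "\<dots> \<longleftrightarrow> (AE x in lebesgue.
      0 < ennreal (indicator (dom_int E) x * weight E x) \<longrightarrow> (norm (cut E f x))\<^sup>2 = 0)"
    unfolding weight_measure_def using weight_density_measurable[OF reg] by (intro AE_density) simp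
  also have "\<dots> \<longleftrightarrow> (AE x in lebesgue. x \<in> dom_int E \<longrightarrow> f x = 0)"
    by (rule eventually_subst, use w in eventually_elim) (auto simp: cut_def indicator_def)
  finally show ?thesis by (simp add: ae_eq_def)
qed

lemma L2w_Cauchy_Schwarz:
  assumes reg: "regular_expr E" and "f \<in> L2w E" "g \<in> L2w E"
  shows "norm (ip E f g) \<le> L2norm E f * L2norm E g"
proof -
  have "(norm (ip E f g))\<^sup>2 \<le> (L2norm E f * L2norm E g)\<^sup>2"
    using assms Cauchy_Schwarz_square_integrable[of "weight_measure E" "cut E f" "cut E g"]
    by (simp add: ip_eq_integral L2norm_sq_eq_integral L2w_iff power_mult_distrib)
  then show ?thesis by (rule power2_le_imp_le) (intro mult_nonneg_nonneg L2norm_nonneg assms)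
qed

lemma ip_tendsto_left:
  assumes reg: "regular_expr E" and f: "\<And>n. f n \<in> L2w E" "g \<in> L2w E" "h \<in> L2w E"
    and lim: "(\<lambda>n. (L2norm E (\<lambda>x. f n x - g x))\<^sup>2) \<longlonglongrightarrow> 0"
  shows "(\<lambda>n. ip E (f n) h) \<longlonglongrightarrow> ip E g h"
proof -
  have "(\<lambda>n. sqrt ((L2norm E (\<lambda>x. f n x - g x))\<^sup>2) * L2norm E h) \<longlonglongrightarrow> sqrt 0 * L2norm E h"
    by (intro tendsto_intros lim)
  then have lim': "(\<lambda>n. L2norm E (\<lambda>x. f n x - g x) * L2norm E h) \<longlonglongrightarrow> 0"
    using L2norm_nonneg[OF reg L2w_diff[OF reg f(1,2)]] by simp
  have "(\<lambda>n. ip E (\<lambda>x. f n x - g x) h) \<longlonglongrightarrow> 0"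
    by (rule Lim_null_comparison[OF _ lim'])
      (use L2w_Cauchy_Schwarz[OF reg L2w_diff[OF reg f(1,2)] f(3)] in simp)
  then have "(\<lambda>n. ip E (f n) h - ip E g h) \<longlonglongrightarrow> 0"
    by (simp add: ip_diff_left[OF reg f])
  then show ?thesis by (rule Lim_null[THEN iffD2])
qed

lemma ip_tendsto_right:
  assumes "regular_expr E" "\<And>n. f n \<in> L2w E" "g \<in> L2w E" "h \<in> L2w E"
    "(\<lambda>n. (L2norm E (\<lambda>x. f n x - g x))\<^sup>2) \<longlonglongrightarrow> 0"
  shows "(\<lambda>n. ip E h (f n)) \<longlonglongrightarrow> ip E h g"
  using tendsto_cnj[OF ip_tendsto_left[OF assms]] by (simp add: ip_cnj)

lemma L2norm_diff_sq_le:
  assumes "regular_expr E" "f \<in> L2w E" "g \<in> L2w E"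
  shows "(L2norm E (\<lambda>x. f x - g x))\<^sup>2 \<le> 2 * (L2norm E f)\<^sup>2 + 2 * (L2norm E g)\<^sup>2"
proof -
  have int: "integrable (weight_measure E) (\<lambda>x. (norm (cut E u x))\<^sup>2)" if "u \<in> L2w E" for u
    using that by (simp add: L2w_iff[OF assms(1)] square_integrable_def)
  have "(LINT x|weight_measure E. (norm (cut E (\<lambda>x. f x - g x) x))\<^sup>2)
     \<le> (LINT x|weight_measure E. 2 * (norm (cut E f x))\<^sup>2 + 2 * (norm (cut E g x))\<^sup>2)"
    by (intro integral_mono int L2w_diff assms Bochner_Integration.integrable_add integrable_mult_right)
      (simp_all add: cut_diff norm_diff_sq_le)
  then show ?thesis
    using assms by (simp add: L2norm_sq_eq_integral L2w_diff int)
qed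

lemma L2w_integrand_integrable:
  assumes reg: "regular_expr E" and "f \<in> L2w E" "g \<in> L2w E"
  shows "set_integrable lebesgue (dom_int E) (\<lambda>x. f x * cnj (g x) * complex_of_real (weight E x))"
proof -
  have int: "integrable (weight_measure E) (\<lambda>x. cut E f x * cnj (cut E g x))"
    using assms by (intro square_integrable_mult_integrable) (simp_all add: L2w_iff)
  then have "(\<lambda>x. cut E f x * cnj (cut E g x)) \<in> borel_measurable lebesgue"
    using measurable_cong_sets[OF sets_weight_measure refl] borel_measurable_integrable by blast
  from integrable_density[OF this weight_density_measurable[OF reg] weight_density_nonneg[OF reg]] int
  have "integrable lebesgue (\<lambda>x. (indicator (dom_int E) x * weight E x) *\<^sub>R (cut E f x * cnj (cut E g x)))"
    by (simp add: weight_measure_def)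
  also have "(\<lambda>x. (indicator (dom_int E) x * weight E x) *\<^sub>R (cut E f x * cnj (cut E g x)))
      = (\<lambda>x. indicator (dom_int E) x *\<^sub>R (f x * cnj (g x) * complex_of_real (weight E x)))"
    by (auto simp: fun_eq_iff cut_def indicator_def scaleR_conv_of_real)
  finally show ?thesis unfolding set_integrable_def .
qed

text \<open>Completeness of Lebesgue measure carries measurability from \<open>f\<close> over to \<open>g\<close>.\<close>

lemma L2w_AE:
  assumes f: "f \<in> L2w E" and "ae_eq E f g"
  shows "g \<in> L2w E"
proof -
  have ae: "AE x in lebesgue. x \<in> dom_int E \<longrightarrow> f x = g x"
    using assms by (simp add: ae_eq_def)
  then have "AE x in lebesgue. indicator (dom_int E) x *\<^sub>R f x = indicator (dom_int E) x *\<^sub>R g x"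
    by eventually_elim (auto simp: indicator_def)
  moreover have "(\<lambda>x. indicator (dom_int E) x *\<^sub>R f x) \<in> borel_measurable lebesgue"
    using f by (simp add: L2w_def set_borel_measurable_def)
  ultimately have "(\<lambda>x. indicator (dom_int E) x *\<^sub>R g x) \<in> borel_measurable lebesgue"
    by (rule borel_measurable_AE[rotated])
  moreover have "integrable lebesgue (\<lambda>x. indicator (dom_int E) x *\<^sub>R ((norm (g x))\<^sup>2 * weight E x))"
  proof (rule integrable_cong_AE_imp)
    show "integrable lebesgue (\<lambda>x. indicator (dom_int E) x *\<^sub>R ((norm (f x))\<^sup>2 * weight E x))"
      using f by (simp add: L2w_def set_integrable_def)
    show eq: "AE x in lebesgue. indicator (dom_int E) x *\<^sub>R ((norm (f x))\<^sup>2 * weight E x)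
        = indicator (dom_int E) x *\<^sub>R ((norm (g x))\<^sup>2 * weight E x)"
      using ae by eventually_elim (auto simp: indicator_def)
    show "(\<lambda>x. indicator (dom_int E) x *\<^sub>R ((norm (g x))\<^sup>2 * weight E x)) \<in> borel_measurable lebesgue"
      using borel_measurable_AE[OF borel_measurable_integrable eq] f
      by (simp add: L2w_def set_integrable_def)
  qed
  ultimately show ?thesis
    by (simp add: L2w_def set_integrable_def set_borel_measurable_def)
qed

lemma L2w_cnj:
  assumes "f \<in> L2w E" shows "(\<lambda>x. cnj (f x)) \<in> L2w E"
proof -
  have [measurable]: "cnj \<in> borel_measurable borel"
    by (intro borel_measurable_continuous_onI continuous_intros)
  have [measurable]: "(\<lambda>x. indicator (dom_int E) x *\<^sub>R f x) \<in> borel_measurable lebesgue"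
    using assms by (simp add: L2w_def set_borel_measurable_def)
  have "(\<lambda>x. cnj (indicator (dom_int E) x *\<^sub>R f x)) \<in> borel_measurable lebesgue" by measurable
  then show ?thesis using assms by (simp add: L2w_def set_borel_measurable_def)
qed

lemma L2norm_cong_AE:
  assumes "regular_expr E" "f \<in> L2w E" "g \<in> L2w E" "ae_eq E f g"
  shows "L2norm E f = L2norm E g"
proof -
  have "ip E f f = ip E g g"
    using ip_cong_AE[OF assms(1,4,2,3,2)] ip_cong_AE_right[OF assms(1,4,2,3,3)] by simp
  then have "(L2norm E f)\<^sup>2 = (L2norm E g)\<^sup>2"
    using assms by (simp add: ip_self flip: of_real_power)
  then show ?thesis using L2norm_nonneg assms by simp
qed

lemma L2w_geometric_Cauchy_limit:
  assumes reg: "regular_expr E" and f: "\<And>n. f n \<in> L2w E"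
    and C: "\<And>n m. n \<le> m \<Longrightarrow> (L2norm E (\<lambda>x. f n x - f m x))\<^sup>2 \<le> C / 4 ^ n"
  obtains g where "g \<in> L2w E" "(\<lambda>n. (L2norm E (\<lambda>x. f n x - g x))\<^sup>2) \<longlonglongrightarrow> 0"
proof -
  have sq: "square_integrable (weight_measure E) (cut E (f n))" for n
    using f by (simp add: L2w_iff[OF reg])
  have "(LINT x|weight_measure E. (norm (cut E (f n) x - cut E (f m) x))\<^sup>2) \<le> C / 4 ^ n"
    if "n \<le> m" for n m
    using C[OF that] by (simp add: L2norm_sq_eq_integral reg L2w_diff f cut_diff)
  from geometric_Cauchy_square_integrable_limit[OF sq this] obtain v where
    v: "square_integrable (weight_measure E) v" and
    le: "\<And>n. (LINT x|weight_measure E. (norm (cut E (f n) x - v x))\<^sup>2) \<le> C / 4 ^ n"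
    by blast
  have [measurable]: "v \<in> borel_measurable (weight_measure E)"
    using v by (simp add: square_integrable_def)
  have "integrable (weight_measure E) (\<lambda>x. (norm (cut E v x))\<^sup>2)"
    by (rule Bochner_Integration.integrable_bound[of _ "\<lambda>x. (norm (v x))\<^sup>2"])
      (use v in \<open>auto simp: square_integrable_def cut_def indicator_def\<close>)
  then have vL: "v \<in> L2w E"
    by (auto simp: L2w_iff[OF reg] square_integrable_def cut_def)
  have bound: "(L2norm E (\<lambda>x. f n x - v x))\<^sup>2 \<le> C / 4 ^ n" for n
  proof -
    have "(L2norm E (\<lambda>x. f n x - v x))\<^sup>2 = (LINT x|weight_measure E. (norm (cut E (\<lambda>x. f n x - v x) x))\<^sup>2)"
      by (intro L2norm_sq_eq_integral L2w_diff reg f vL)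
    also have "\<dots> \<le> (LINT x|weight_measure E. (norm (cut E (f n) x - v x))\<^sup>2)"
      using square_integrable_diff[OF sq v, of n] L2w_diff[OF reg f vL, of n]
      by (intro integral_mono) (auto simp: L2w_iff[OF reg] square_integrable_def cut_def indicator_def)
    finally show ?thesis using le[of n] by simp
  qed
  have "(\<lambda>n. C * (1/4) ^ n) \<longlonglongrightarrow> C * 0"
    by (intro tendsto_intros LIMSEQ_power_zero) simp
  then have "(\<lambda>n. C / 4 ^ n) \<longlonglongrightarrow> 0" by (simp add: power_one_over)
  from tendsto_sandwich[OF _ _ tendsto_const this, of "\<lambda>n. (L2norm E (\<lambda>x. f n x - v x))\<^sup>2"]
  have "(\<lambda>n. (L2norm E (\<lambda>x. f n x - v x))\<^sup>2) \<longlonglongrightarrow> 0"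
    using bound by simp
  with vL show ?thesis by (rule that)
qed

section \<open>Linearity of the differential expression and the sesquilinear form\<close>

lemma abs_cont_on_lincomb:
  assumes f: "abs_cont_on c d f" and g: "abs_cont_on c d g"
  shows "abs_cont_on c d (\<lambda>x. \<alpha> * f x + g x)"
  unfolding abs_cont_on_def
proof (intro allI impI)
  fix e :: real assume e: "0 < e"
  define e1 where "e1 = e / (2 * (norm \<alpha> + 1))"
  have pos: "0 < norm \<alpha> + 1" by (simp add: add_nonneg_pos)
  have e1: "0 < e1" "norm \<alpha> * e1 \<le> e / 2"
    using e pos by (simp_all add: e1_def field_simps)
  obtain d1 where d1: "d1 > 0" "\<And>(n::nat) s t. (\<forall>i<n. c \<le> s i \<and> s i \<le> t i \<and> t i \<le> d) \<and>
        (\<forall>i<n. \<forall>j<n. i \<noteq> j \<longrightarrow> {s i<..<t i} \<inter> {s j<..<t j} = {}) \<and>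
        (\<Sum>i<n. t i - s i) < d1 \<Longrightarrow> (\<Sum>i<n. norm (f (t i) - f (s i))) < e1"
    using f e1(1) unfolding abs_cont_on_def by blast
  obtain d2 where d2: "d2 > 0" "\<And>(n::nat) s t. (\<forall>i<n. c \<le> s i \<and> s i \<le> t i \<and> t i \<le> d) \<and>
        (\<forall>i<n. \<forall>j<n. i \<noteq> j \<longrightarrow> {s i<..<t i} \<inter> {s j<..<t j} = {}) \<and>
        (\<Sum>i<n. t i - s i) < d2 \<Longrightarrow> (\<Sum>i<n. norm (g (t i) - g (s i))) < e / 2"
    using g half_gt_zero[OF e] unfolding abs_cont_on_def by blast
  show "\<exists>\<delta>>0. \<forall>(n::nat) s t. (\<forall>i<n. c \<le> s i \<and> s i \<le> t i \<and> t i \<le> d) \<and>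
        (\<forall>i<n. \<forall>j<n. i \<noteq> j \<longrightarrow> {s i<..<t i} \<inter> {s j<..<t j} = {}) \<and>
        (\<Sum>i<n. t i - s i) < \<delta> \<longrightarrow>
        (\<Sum>i<n. norm (\<alpha> * f (t i) + g (t i) - (\<alpha> * f (s i) + g (s i)))) < e"
  proof (intro exI[of _ "min d1 d2"] conjI allI impI)
    show "0 < min d1 d2" using d1(1) d2(1) by simp
    fix n :: nat and s t
    assume A: "(\<forall>i<n. c \<le> s i \<and> s i \<le> t i \<and> t i \<le> d) \<and>
        (\<forall>i<n. \<forall>j<n. i \<noteq> j \<longrightarrow> {s i<..<t i} \<inter> {s j<..<t j} = {}) \<and>
        (\<Sum>i<n. t i - s i) < min d1 d2"
    have "(\<Sum>i<n. norm (\<alpha> * f (t i) + g (t i) - (\<alpha> * f (s i) + g (s i))))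
        \<le> (\<Sum>i<n. norm \<alpha> * norm (f (t i) - f (s i)) + norm (g (t i) - g (s i)))"
    proof (rule sum_mono)
      fix i
      have "\<alpha> * f (t i) + g (t i) - (\<alpha> * f (s i) + g (s i))
          = \<alpha> * (f (t i) - f (s i)) + (g (t i) - g (s i))" by (simp add: algebra_simps)
      then show "norm (\<alpha> * f (t i) + g (t i) - (\<alpha> * f (s i) + g (s i)))
          \<le> norm \<alpha> * norm (f (t i) - f (s i)) + norm (g (t i) - g (s i))"
        by (metis norm_mult norm_triangle_ineq)
    qed
    also have "\<dots> = norm \<alpha> * (\<Sum>i<n. norm (f (t i) - f (s i))) + (\<Sum>i<n. norm (g (t i) - g (s i)))"
      by (simp add: sum.distrib sum_distrib_left)
    also have "\<dots> < e / 2 + e / 2"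
    proof (rule add_le_less_mono)
      have "(\<Sum>i<n. norm (f (t i) - f (s i))) < e1" using d1(2)[of n s t] A by auto
      then have "norm \<alpha> * (\<Sum>i<n. norm (f (t i) - f (s i))) \<le> norm \<alpha> * e1"
        by (intro mult_left_mono) auto
      with e1(2) show "norm \<alpha> * (\<Sum>i<n. norm (f (t i) - f (s i))) \<le> e / 2" by linarith
      show "(\<Sum>i<n. norm (g (t i) - g (s i))) < e / 2" using d2(2)[of n s t] A by auto
    qed
    finally show "(\<Sum>i<n. norm (\<alpha> * f (t i) + g (t i) - (\<alpha> * f (s i) + g (s i)))) < e" by simp
  qed
qed

lemma abs_cont_on_cnj: "abs_cont_on c d f \<Longrightarrow> abs_cont_on c d (\<lambda>x. cnj (f x))"
  unfolding abs_cont_on_def by (simp flip: complex_cnj_diff)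

lemma derivs_of_lincomb:
  assumes F: "derivs_of E f F" and G: "derivs_of E g G"
  shows "derivs_of E (\<lambda>x. \<alpha> * f x + g x) (\<lambda>r x. \<alpha> * F r x + G r x)"
  unfolding derivs_of_def
proof (intro conjI allI impI ballI)
  fix x assume "x \<in> dom_int E"
  then show "\<alpha> * F 0 x + G 0 x = \<alpha> * f x + g x" using F G by (simp add: derivs_of_def)
next
  fix r assume r: "r < ord_of E"
  show "ac_loc (dom_int E) (\<lambda>x. \<alpha> * F r x + G r x)"
    using F G r by (simp add: derivs_of_def ac_loc_def abs_cont_on_lincomb)
  have "AE x in lebesgue. x \<in> dom_int E \<longrightarrow>
        (F r has_vector_derivative (\<Sum>s\<le>Suc r. complex_of_real (coeff E r s x) * F s x)) (at x)"
    "AE x in lebesgue. x \<in> dom_int E \<longrightarrow>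
        (G r has_vector_derivative (\<Sum>s\<le>Suc r. complex_of_real (coeff E r s x) * G s x)) (at x)"
    using F G r by (simp_all add: derivs_of_def)
  then show "AE x in lebesgue. x \<in> dom_int E \<longrightarrow> ((\<lambda>x. \<alpha> * F r x + G r x) has_vector_derivative
      (\<Sum>s\<le>Suc r. complex_of_real (coeff E r s x) * (\<alpha> * F s x + G s x))) (at x)"
  proof eventually_elim
    case (elim x)
    have eq: "(\<Sum>s\<le>Suc r. complex_of_real (coeff E r s x) * (\<alpha> * F s x + G s x))
        = \<alpha> * (\<Sum>s\<le>Suc r. complex_of_real (coeff E r s x) * F s x)
          + (\<Sum>s\<le>Suc r. complex_of_real (coeff E r s x) * G s x)"
      unfolding sum_distrib_left sum.distrib[symmetric] by (simp only: distrib_left mult.left_commute)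
    show ?case unfolding eq
      using elim by (auto intro!: has_vector_derivative_add has_vector_derivative_mult_right)
  qed
qed

lemma derivs_of_cnj:
  assumes F: "derivs_of E f F"
  shows "derivs_of E (\<lambda>x. cnj (f x)) (\<lambda>r x. cnj (F r x))"
  unfolding derivs_of_def
proof (intro conjI allI impI ballI)
  fix x assume "x \<in> dom_int E"
  then show "cnj (F 0 x) = cnj (f x)" using F by (simp add: derivs_of_def)
next
  fix r assume r: "r < ord_of E"
  show "ac_loc (dom_int E) (\<lambda>x. cnj (F r x))"
    using F r by (simp add: derivs_of_def ac_loc_def abs_cont_on_cnj)
  have "AE x in lebesgue. x \<in> dom_int E \<longrightarrow>
        (F r has_vector_derivative (\<Sum>s\<le>Suc r. complex_of_real (coeff E r s x) * F s x)) (at x)"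
    using F r by (simp add: derivs_of_def)
  then show "AE x in lebesgue. x \<in> dom_int E \<longrightarrow> ((\<lambda>x. cnj (F r x)) has_vector_derivative
      (\<Sum>s\<le>Suc r. complex_of_real (coeff E r s x) * cnj (F s x))) (at x)"
  proof eventually_elim
    case (elim x)
    have "(\<Sum>s\<le>Suc r. complex_of_real (coeff E r s x) * cnj (F s x))
        = cnj (\<Sum>s\<le>Suc r. complex_of_real (coeff E r s x) * F s x)" by simp
    with elim show ?case by (metis has_vector_derivative_cnj)
  qed
qed

lemma ell_lincomb:
  assumes reg: "regular_expr E" and F: "derivs_of E f F" and G: "derivs_of E g G"
  shows "ae_eq E (ell E (\<lambda>x. \<alpha> * f x + g x)) (\<lambda>x. \<alpha> * ell E f x + ell E g x)"
  using ell_AE_unique[OF reg F] ell_AE_unique[OF reg G]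
    ell_AE_unique[OF reg derivs_of_lincomb[OF F G, of \<alpha>]]
  unfolding ae_eq_def by eventually_elim auto

lemma ell_cnj:
  assumes reg: "regular_expr E" and F: "derivs_of E f F"
  shows "ae_eq E (ell E (\<lambda>x. cnj (f x))) (\<lambda>x. cnj (ell E f x))"
  using ell_AE_unique[OF reg F] ell_AE_unique[OF reg derivs_of_cnj[OF F]]
  unfolding ae_eq_def by eventually_elim auto

lemma ae_eq_sym:
  assumes "ae_eq E f g" shows "ae_eq E g f"
  using assms unfolding ae_eq_def by eventually_elim auto

lemma Dmax_L2w: "f \<in> Dmax E \<Longrightarrow> f \<in> L2w E" "f \<in> Dmax E \<Longrightarrow> ell E f \<in> L2w E"
  by (simp_all add: Dmax_def)

lemma ell_lincomb_Dmax:
  assumes "regular_expr E" "f \<in> Dmax E" "g \<in> Dmax E"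
  shows "ae_eq E (ell E (\<lambda>x. \<alpha> * f x + g x)) (\<lambda>x. \<alpha> * ell E f x + ell E g x)"
  using assms ell_lincomb by (auto simp: Dmax_def)

text \<open>\<open>ell\<close> picks some representative, so that even its value at \<open>0\<close> is known only up to a null set.\<close>

lemma ell_zero:
  assumes "regular_expr E" "(\<lambda>x. 0) \<in> Dmax E"
  shows "ae_eq E (ell E (\<lambda>x. 0)) (\<lambda>x. 0)"
  using ell_lincomb_Dmax[OF assms assms(2), of "-1"] by simp

lemma Dmax_lincomb:
  assumes reg: "regular_expr E" and f: "f \<in> Dmax E" and g: "g \<in> Dmax E"
  shows "(\<lambda>x. \<alpha> * f x + g x) \<in> Dmax E"
proof -
  have "(\<lambda>x. \<alpha> * ell E f x + ell E g x) \<in> L2w E"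
    by (intro L2w_add L2w_scale reg Dmax_L2w f g)
  then have "ell E (\<lambda>x. \<alpha> * f x + g x) \<in> L2w E"
    using ae_eq_sym[OF ell_lincomb_Dmax[OF assms]] by (rule L2w_AE)
  moreover have "(\<lambda>x. \<alpha> * f x + g x) \<in> L2w E"
    by (intro L2w_add L2w_scale reg Dmax_L2w f g)
  moreover have "\<exists>F. derivs_of E (\<lambda>x. \<alpha> * f x + g x) F"
    using f g derivs_of_lincomb unfolding Dmax_def by blast
  ultimately show ?thesis using f g by (simp add: Dmax_def)
qed

text \<open>The form is defined by \<open>\<ell>[cnj g]\<close>; the coefficients being real, this is \<open>cnj (\<ell>[g])\<close>, and the
  form measures how far \<open>\<ell>\<close> is from being symmetric on the pair \<open>f\<close>, \<open>g\<close>.\<close>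

lemma sform_eq_ip:
  assumes reg: "regular_expr E" and f: "f \<in> Dmax E" and g: "g \<in> Dmax E"
  shows "sform E f g = ip E (ell E f) g - ip E f (ell E g)"
proof -
  obtain G where G: "derivs_of E g G" using g by (auto simp: Dmax_def)
  let ?c = "\<lambda>u x. cnj (u x)"
  have ellc: "ell E (?c g) \<in> L2w E"
    using L2w_cnj[OF Dmax_L2w(2)[OF g]] ae_eq_sym[OF ell_cnj[OF reg G]] by (rule L2w_AE)
  have "sform E f g = ip E (ell E f) g - ip E (ell E (?c g)) (?c f)"
    using L2w_integrand_integrable[OF reg Dmax_L2w(2)[OF f] Dmax_L2w(1)[OF g]]
      L2w_integrand_integrable[OF reg ellc L2w_cnj[OF Dmax_L2w(1)[OF f]]]
    unfolding sform_def ip_def by (simp add: left_diff_distrib)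
  also have "ip E (ell E (?c g)) (?c f) = ip E (?c (ell E g)) (?c f)"
    by (intro ip_cong_AE reg ell_cnj[OF reg G] ellc L2w_cnj Dmax_L2w f g)
  also have "\<dots> = ip E f (ell E g)"
    unfolding ip_def by (simp add: mult_ac)
  finally show ?thesis .
qed

lemma sform_skew:
  assumes "regular_expr E" "f \<in> Dmax E" "g \<in> Dmax E"
  shows "sform E g f = - cnj (sform E f g)"
  using assms by (simp add: sform_eq_ip ip_cnj)

lemma sform_lincomb_left:
  assumes reg: "regular_expr E" and f: "f \<in> Dmax E" and g: "g \<in> Dmax E" and h: "h \<in> Dmax E"
  shows "sform E (\<lambda>x. \<alpha> * f x + g x) h = \<alpha> * sform E f h + sform E g h"
proof -
  have "ip E (ell E (\<lambda>x. \<alpha> * f x + g x)) h = ip E (\<lambda>x. \<alpha> * ell E f x + ell E g x) h"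
    by (intro ip_cong_AE reg ell_lincomb_Dmax f g Dmax_L2w Dmax_lincomb L2w_add L2w_scale h)
  then have "ip E (ell E (\<lambda>x. \<alpha> * f x + g x)) h = \<alpha> * ip E (ell E f) h + ip E (ell E g) h"
    by (simp add: ip_add_left L2w_scale Dmax_L2w ip_scale_left reg f g h)
  moreover have "ip E (\<lambda>x. \<alpha> * f x + g x) (ell E h) = \<alpha> * ip E f (ell E h) + ip E g (ell E h)"
    by (simp add: ip_add_left L2w_scale Dmax_L2w ip_scale_left reg f g h)
  ultimately show ?thesis
    unfolding sform_eq_ip[OF reg Dmax_lincomb[OF reg f g] h] sform_eq_ip[OF reg f h]
      sform_eq_ip[OF reg g h] by (simp add: algebra_simps)
qed

lemma sform_sum_left:
  assumes reg: "regular_expr E" and "finite I" and "(\<lambda>x. 0) \<in> Dmax E"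
    and u: "\<And>i. i \<in> I \<Longrightarrow> u i \<in> Dmax E"
  shows "(\<lambda>x. \<Sum>i\<in>I. c i * u i x) \<in> Dmax E"
    and "h \<in> Dmax E \<Longrightarrow> sform E (\<lambda>x. \<Sum>i\<in>I. c i * u i x) h = (\<Sum>i\<in>I. c i * sform E (u i) h)"
proof -
  have "(\<lambda>x. \<Sum>i\<in>I. c i * u i x) \<in> Dmax E \<and> (h \<in> Dmax E \<longrightarrow>
      sform E (\<lambda>x. \<Sum>i\<in>I. c i * u i x) h = (\<Sum>i\<in>I. c i * sform E (u i) h))" for h
    using assms(2) u
  proof (induction I rule: finite_induct)
    case empty
    then show ?case
      using assms(3) sform_lincomb_left[OF reg assms(3) assms(3), of h "-1"] by simp
  next
    case (insert i I)
    then show ?case by (simp add: Dmax_lincomb[OF reg] sform_lincomb_left[OF reg])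
  qed
  then show "(\<lambda>x. \<Sum>i\<in>I. c i * u i x) \<in> Dmax E"
    and "h \<in> Dmax E \<Longrightarrow> sform E (\<lambda>x. \<Sum>i\<in>I. c i * u i x) h = (\<Sum>i\<in>I. c i * sform E (u i) h)"
    by blast+
qed

section \<open>Decomposition of the maximal domain by a self-adjoint operator\<close>

lemma self_adjoint_symmetric:
  assumes sa: "self_adjoint_op E (ell E) D" and D: "D \<subseteq> Dmax E" and f: "f \<in> D" and g: "g \<in> D"
  shows "ip E (ell E f) g = ip E f (ell E g)"
proof -
  have "(g, ell E g) \<in> op_graph E (ell E) D"
    using g D Dmax_L2w by (auto simp: op_graph_def ae_eq_def)
  then have "(g, ell E g) \<in> adjoint_graph E (ell E) D"
    using sa by (simp add: self_adjoint_op_def)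
  with f show ?thesis by (simp add: adjoint_graph_def)
qed

lemma subspace_lincomb:
  assumes "cfun.subspace D" "f \<in> D" "g \<in> D"
  shows "(\<lambda>x. \<alpha> * f x + g x) \<in> D"
proof -
  have "(\<lambda>x. \<alpha> * f x) + g \<in> D"
    using assms cfun.subspace_add cfun.subspace_scale by blast
  then show ?thesis by (simp add: plus_fun_def)
qed

text \<open>For \<open>g = T f\<close> with \<open>T\<close> symmetric, the cross terms of \<open>\<parallel>T f - \<i> f\<parallel>\<^sup>2\<close> cancel, leaving
  \<open>\<parallel>T f\<parallel>\<^sup>2 + \<parallel>f\<parallel>\<^sup>2\<close>. Hence \<open>T - \<i>\<close> is injective with a bounded inverse on its range.\<close>

lemma norm_le_norm_shift:
  assumes reg: "regular_expr E" and f: "f \<in> L2w E" and g: "g \<in> L2w E"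
    and sym: "ip E g f = ip E f g"
  shows "(L2norm E f)\<^sup>2 \<le> (L2norm E (\<lambda>x. g x - \<i> * f x))\<^sup>2"
proof -
  have L: "(\<lambda>x. \<i> * f x) \<in> L2w E" "(\<lambda>x. g x - \<i> * f x) \<in> L2w E"
    by (intro L2w_scale L2w_diff reg f g)+
  have "ip E (\<lambda>x. g x - \<i> * f x) (\<lambda>x. g x - \<i> * f x) = ip E g g + ip E f f"
    using sym
    by (simp add: ip_diff_left ip_diff_right ip_scale_left ip_scale_right reg f g L algebra_simps)
  then have "(L2norm E (\<lambda>x. g x - \<i> * f x))\<^sup>2 = (L2norm E g)\<^sup>2 + (L2norm E f)\<^sup>2"
    unfolding ip_self[OF reg f] ip_self[OF reg g] ip_self[OF reg L(2)]
    by (metis of_real_add of_real_eq_iff)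
  then show ?thesis by simp
qed

text \<open>The range of \<open>T - \<i>\<close> is closed for a self-adjoint \<open>T\<close>: if \<open>(T - \<i>) g\<^sub>n\<close> converges to \<open>h\<close>,
  then \<open>g\<^sub>n\<close> is Cauchy by the preceding estimate, and passing to the limit in
  \<open>\<langle>T f, g\<^sub>n\<rangle> = \<langle>f, T g\<^sub>n\<rangle>\<close> places the pair \<open>(lim g\<^sub>n, h + \<i> lim g\<^sub>n)\<close> in the graph of the adjoint,
  which is the graph of \<open>T\<close>.\<close>

lemma self_adjoint_shift_range_closed:
  assumes reg: "regular_expr E" and D: "D \<subseteq> Dmax E" and sa: "self_adjoint_op E (ell E) D"
    and h: "h \<in> L2w E"
    and approx: "\<And>\<epsilon>. \<epsilon> > 0 \<Longrightarrow> \<exists>g\<in>D. L2norm E (\<lambda>x. h x - (ell E g x - \<i> * g x)) < \<epsilon>"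
  shows "\<exists>g\<in>D. ae_eq E h (\<lambda>x. ell E g x - \<i> * g x)"
proof -
  have sub: "cfun.subspace D" using sa by (simp add: self_adjoint_op_def)
  have "\<forall>n. \<exists>g\<in>D. L2norm E (\<lambda>x. h x - (ell E g x - \<i> * g x)) < (1/2) ^ n"
    using approx by simp
  then obtain g where gD: "\<And>n. g n \<in> D"
    and close: "\<And>n. L2norm E (\<lambda>x. h x - (ell E (g n) x - \<i> * g n x)) < (1/2) ^ n"
    by metis
  have gL: "g n \<in> L2w E" "ell E (g n) \<in> L2w E" for n
    using gD D Dmax_L2w by blast+
  define k where "k = (\<lambda>n x. ell E (g n) x - \<i> * g n x)"
  have kL: "k n \<in> L2w E" for n
    unfolding k_def by (intro L2w_diff L2w_scale reg gL)
  have hk: "(L2norm E (\<lambda>x. h x - k n x))\<^sup>2 \<le> (1/4) ^ n" for n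
  proof -
    have "(L2norm E (\<lambda>x. h x - k n x))\<^sup>2 \<le> ((1/2) ^ n)\<^sup>2"
      using close[of n] L2norm_nonneg[OF reg L2w_diff[OF reg h kL[of n]]]
      by (intro power_mono) (simp_all add: k_def)
    also have "((1/2 :: real) ^ n)\<^sup>2 = (1/4) ^ n"
      by (simp add: power2_eq_square flip: power_mult_distrib)
    finally show ?thesis .
  qed
  have Cauchy: "(L2norm E (\<lambda>x. g n x - g m x))\<^sup>2 \<le> 4 / 4 ^ n" if nm: "n \<le> m" for n m
  proof -
    let ?d = "\<lambda>x. - 1 * g m x + g n x"
    have dD: "?d \<in> D" by (rule subspace_lincomb[OF sub gD gD])
    then have dmax: "?d \<in> Dmax E" using D by blast
    have "(L2norm E ?d)\<^sup>2 \<le> (L2norm E (\<lambda>x. ell E ?d x - \<i> * ?d x))\<^sup>2"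
      by (intro norm_le_norm_shift reg Dmax_L2w dmax self_adjoint_symmetric[OF sa D dD dD])
    also have "L2norm E (\<lambda>x. ell E ?d x - \<i> * ?d x) = L2norm E (\<lambda>x. (h x - k m x) - (h x - k n x))"
    proof (rule L2norm_cong_AE[OF reg])
      show "(\<lambda>x. ell E ?d x - \<i> * ?d x) \<in> L2w E"
        by (intro L2w_diff[OF reg _ L2w_scale[OF reg]] Dmax_L2w dmax)
      show "(\<lambda>x. (h x - k m x) - (h x - k n x)) \<in> L2w E"
        by (intro L2w_diff reg h kL)
      have "ae_eq E (ell E ?d) (\<lambda>x. - 1 * ell E (g m) x + ell E (g n) x)"
        using gD D by (intro ell_lincomb_Dmax reg) blast+
      then show "ae_eq E (\<lambda>x. ell E ?d x - \<i> * ?d x) (\<lambda>x. (h x - k m x) - (h x - k n x))"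
        unfolding ae_eq_def by eventually_elim (auto simp: k_def algebra_simps)
    qed
    also have "(L2norm E (\<lambda>x. (h x - k m x) - (h x - k n x)))\<^sup>2
        \<le> 2 * (L2norm E (\<lambda>x. h x - k m x))\<^sup>2 + 2 * (L2norm E (\<lambda>x. h x - k n x))\<^sup>2"
      by (intro L2norm_diff_sq_le L2w_diff reg h kL)
    also have "\<dots> \<le> 2 * (1/4) ^ m + 2 * (1/4) ^ n"
      using hk[of n] hk[of m] by linarith
    also have "\<dots> \<le> 2 * (1/4) ^ n + 2 * (1/4) ^ n"
      using nm by (intro add_mono mult_left_mono power_decreasing) auto
    finally show ?thesis by (simp add: power_one_over)
  qed
  obtain v where v: "v \<in> L2w E" and lim_v: "(\<lambda>n. (L2norm E (\<lambda>x. g n x - v x))\<^sup>2) \<longlonglongrightarrow> 0"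
    using L2w_geometric_Cauchy_limit[of E g 4, OF reg gL(1) Cauchy] by blast
  have lim_k: "(\<lambda>n. (L2norm E (\<lambda>x. k n x - h x))\<^sup>2) \<longlonglongrightarrow> 0"
  proof (rule tendsto_sandwich[OF _ _ tendsto_const])
    have "L2norm E (\<lambda>x. k n x - h x) = L2norm E (\<lambda>x. h x - k n x)" for n
      by (simp add: L2norm_def norm_minus_commute)
    then show "\<forall>\<^sub>F n in sequentially. (L2norm E (\<lambda>x. k n x - h x))\<^sup>2 \<le> (1/4) ^ n"
      using hk by simp
    show "(\<lambda>n. (1/4 :: real) ^ n) \<longlonglongrightarrow> 0" by (intro LIMSEQ_power_zero) simp
  qed simp
  let ?w = "\<lambda>x. h x + \<i> * v x"
  have wL: "?w \<in> L2w E" by (intro L2w_add L2w_scale reg h v)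
  have "ip E (ell E f) v = ip E f ?w" if f: "f \<in> D" for f
  proof (rule LIMSEQ_unique)
    have fL: "f \<in> L2w E" "ell E f \<in> L2w E" using f D Dmax_L2w by blast+
    show "(\<lambda>n. ip E (ell E f) (g n)) \<longlonglongrightarrow> ip E (ell E f) v"
      by (rule ip_tendsto_right[OF reg gL(1) v fL(2) lim_v])
    have "ip E (ell E f) (g n) = ip E f (k n) + cnj \<i> * ip E f (g n)" for n
    proof -
      have "ip E (ell E f) (g n) = ip E f (ell E (g n))"
        by (rule self_adjoint_symmetric[OF sa D f gD])
      also have "\<dots> = ip E f (\<lambda>x. k n x + \<i> * g n x)" by (simp add: k_def)
      also have "\<dots> = ip E f (k n) + cnj \<i> * ip E f (g n)"
        by (simp add: ip_add_right reg kL L2w_scale gL fL ip_scale_right del: complex_cnj_i)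
      finally show ?thesis .
    qed
    moreover have "(\<lambda>n. ip E f (k n) + cnj \<i> * ip E f (g n)) \<longlonglongrightarrow> ip E f h + cnj \<i> * ip E f v"
      by (intro tendsto_add tendsto_mult tendsto_const ip_tendsto_right[OF reg kL h fL(1) lim_k]
          ip_tendsto_right[OF reg gL(1) v fL(1) lim_v])
    moreover have "ip E f ?w = ip E f h + cnj \<i> * ip E f v"
      by (simp add: ip_add_right reg h L2w_scale v fL ip_scale_right del: complex_cnj_i)
    ultimately show "(\<lambda>n. ip E (ell E f) (g n)) \<longlonglongrightarrow> ip E f ?w" by simp
  qed
  then have "(v, ?w) \<in> adjoint_graph E (ell E) D"
    using v wL by (simp add: adjoint_graph_def)
  then have "(v, ?w) \<in> op_graph E (ell E) D"
    using sa by (simp add: self_adjoint_op_def)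
  then obtain f where f: "f \<in> D" "ae_eq E v f" "ae_eq E ?w (ell E f)"
    by (auto simp: op_graph_def)
  have "ae_eq E h (\<lambda>x. ell E f x - \<i> * f x)"
    using f(2,3) unfolding ae_eq_def by eventually_elim (auto simp: algebra_simps)
  with f(1) show ?thesis by blast
qed

text \<open>The eigenvalues of a symmetric operator are real, so that \<open>p = (T - \<i>) (p / (\<mu> - \<i>))\<close> for every
  eigenfunction \<open>p\<close>.\<close>

lemma eigenfunction_span_subset_shift_range:
  assumes reg: "regular_expr E" and D: "D \<subseteq> Dmax E" and sa: "self_adjoint_op E (ell E) D"
    and ev: "\<And>p. p \<in> S \<Longrightarrow> p \<in> D \<and> \<not> ae_eq E p (\<lambda>x. 0) \<and> (\<exists>\<mu>. ae_eq E (ell E p) (\<lambda>x. \<mu> * p x))"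
    and u: "u \<in> cfun.span S"
  shows "\<exists>g\<in>D. ae_eq E u (\<lambda>x. ell E g x - \<i> * g x)"
  using u
proof (induction u rule: cfun.span_induct_alt)
  case base
  have sub: "cfun.subspace D" using sa by (simp add: self_adjoint_op_def)
  have zero: "(\<lambda>x. 0) \<in> D" using cfun.subspace_0[OF sub] by (simp add: zero_fun_def)
  then have "(\<lambda>x. 0) \<in> Dmax E" using D by blast
  from ae_eq_sym[OF ell_zero[OF reg this]]
  have "ae_eq E 0 (\<lambda>x. ell E (\<lambda>x. 0) x - \<i> * 0)" by (simp add: zero_fun_def)
  then show ?case by (rule bexI[where x = "\<lambda>x. 0", OF _ zero])
next
  case (step c p y)
  have sub: "cfun.subspace D" using sa by (simp add: self_adjoint_op_def)
  obtain g where g: "g \<in> D" "ae_eq E y (\<lambda>x. ell E g x - \<i> * g x)" using step(2) by blast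
  obtain \<mu> where p: "p \<in> D" "\<not> ae_eq E p (\<lambda>x. 0)" and \<mu>: "ae_eq E (ell E p) (\<lambda>x. \<mu> * p x)"
    using ev[OF step(1)] by blast
  have pL: "p \<in> L2w E" "ell E p \<in> L2w E" using p D Dmax_L2w by blast+
  have "\<mu> * ip E p p = ip E (ell E p) p"
    using ip_cong_AE[OF reg \<mu> pL(2) L2w_scale[OF reg pL(1)] pL(1)] by (simp add: ip_scale_left)
  also have "\<dots> = ip E p (ell E p)" by (rule self_adjoint_symmetric[OF sa D p(1) p(1)])
  also have "\<dots> = cnj \<mu> * ip E p p"
    using ip_cong_AE_right[OF reg \<mu> pL(2) L2w_scale[OF reg pL(1)] pL(1)] by (simp add: ip_scale_right)
  finally have "\<mu> = cnj \<mu>"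
    using ae_eq_zero_iff_L2norm[OF reg pL(1)] p(2) ip_self[OF reg pL(1)] by simp
  then have ne: "\<mu> - \<i> \<noteq> 0" by (auto simp: complex_eq_iff)
  then obtain q where q: "c = q * (\<mu> - \<i>)" by (metis nonzero_divide_eq_eq)
  define f where "f = (\<lambda>x. q * p x + g x)"
  have "f \<in> D" unfolding f_def by (rule subspace_lincomb[OF sub p(1) g(1)])
  moreover have "ae_eq E (ell E f) (\<lambda>x. q * ell E p x + ell E g x)"
    unfolding f_def using p(1) g(1) D by (intro ell_lincomb_Dmax reg) blast+
  then have "ae_eq E ((\<lambda>x. c * p x) + y) (\<lambda>x. ell E f x - \<i> * f x)"
    using \<mu> g(2) unfolding ae_eq_def
  proof eventually_elim
    case (elim x)
    then show ?case by (auto simp: f_def q algebra_simps)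
  qed
  ultimately show ?case by blast
qed

lemma self_adjoint_shift_surj:
  assumes reg: "regular_expr E" and D: "D \<subseteq> Dmax E" and sa: "self_adjoint_op E (ell E) D"
    and P: "complete_orthogonal_eigenfunctions E (ell E) D P" and h: "h \<in> L2w E"
  shows "\<exists>g\<in>D. ae_eq E h (\<lambda>x. ell E g x - \<i> * g x)"
proof (rule self_adjoint_shift_range_closed[OF reg D sa h])
  fix \<epsilon> :: real assume "\<epsilon> > 0"
  then obtain u where u: "u \<in> cfun.span (range P)" "L2norm E (\<lambda>x. h x - u x) < \<epsilon>"
    using P h unfolding complete_orthogonal_eigenfunctions_def dense_L2_def by blast
  have "\<And>p. p \<in> range P \<Longrightarrow> p \<in> D \<and> \<not> ae_eq E p (\<lambda>x. 0) \<and> (\<exists>\<mu>. ae_eq E (ell E p) (\<lambda>x. \<mu> * p x))"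
    using P by (auto simp: complete_orthogonal_eigenfunctions_def)
  from eigenfunction_span_subset_shift_range[OF reg D sa this u(1)]
  obtain g where g: "g \<in> D" "ae_eq E u (\<lambda>x. ell E g x - \<i> * g x)" by blast
  have kL: "(\<lambda>x. ell E g x - \<i> * g x) \<in> L2w E"
    using Dmax_L2w[of g E] g(1) D by (intro L2w_diff[OF reg _ L2w_scale[OF reg]]) auto
  have uL: "u \<in> L2w E" using kL ae_eq_sym[OF g(2)] by (rule L2w_AE)
  have "ae_eq E (\<lambda>x. h x - (ell E g x - \<i> * g x)) (\<lambda>x. h x - u x)"
    using g(2) unfolding ae_eq_def by eventually_elim auto
  then have "L2norm E (\<lambda>x. h x - (ell E g x - \<i> * g x)) = L2norm E (\<lambda>x. h x - u x)"
    by (intro L2norm_cong_AE reg L2w_diff h kL uL)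
  with u(2) have "L2norm E (\<lambda>x. h x - (ell E g x - \<i> * g x)) < \<epsilon>" by simp
  then show "\<exists>g\<in>D. L2norm E (\<lambda>x. h x - (ell E g x - \<i> * g x)) < \<epsilon>"
    by (rule bexI[OF _ g(1)])
qed

text \<open>Solving \<open>(\<ell> - \<i>) g = (\<ell> - \<i>) f\<close> in the domain of the self-adjoint operator leaves the
  difference \<open>f - g\<close> in the defect space.\<close>

lemma Dmax_eq_self_adjoint_plus_Dplus:
  assumes reg: "regular_expr E" and D: "D \<subseteq> Dmax E" and sa: "self_adjoint_op E (ell E) D"
    and P: "complete_orthogonal_eigenfunctions E (ell E) D P" and f: "f \<in> Dmax E"
  obtains g h where "g \<in> D" "h \<in> Dplus E" "f = (\<lambda>x. h x + g x)"
proof -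
  have "(\<lambda>x. ell E f x - \<i> * f x) \<in> L2w E"
    by (intro L2w_diff L2w_scale reg Dmax_L2w f)
  from self_adjoint_shift_surj[OF reg D sa P this] obtain g where
    g: "g \<in> D" "ae_eq E (\<lambda>x. ell E f x - \<i> * f x) (\<lambda>x. ell E g x - \<i> * g x)" by blast
  define h where "h = (\<lambda>x. - 1 * g x + f x)"
  have gmax: "g \<in> Dmax E" using g(1) D by blast
  have "h \<in> Dmax E" unfolding h_def by (rule Dmax_lincomb[OF reg gmax f])
  moreover have "ae_eq E (ell E h) (\<lambda>x. \<i> * h x)"
    using ell_lincomb_Dmax[OF reg gmax f, of "-1"] g(2) unfolding ae_eq_def h_def
  proof eventually_elim
    case (elim x)
    show ?case
    proof
      assume "x \<in> dom_int E"
      with elim have "ell E (\<lambda>x. - 1 * g x + f x) x = ell E f x - ell E g x"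
        and "ell E f x - \<i> * f x = ell E g x - \<i> * g x" by simp_all
      then show "ell E (\<lambda>x. - 1 * g x + f x) x = \<i> * (- 1 * g x + f x)" by algebra
    qed
  qed
  ultimately have "h \<in> Dplus E" by (simp add: Dplus_def)
  with g(1) show ?thesis by (rule that) (simp add: h_def)
qed

section \<open>Isotropic subspaces and GKN conditions\<close>

lemma cfun_span_finite:
  assumes B: "finite B" and h: "h \<in> cfun.span B"
  obtains c where "h = (\<lambda>x. \<Sum>b\<in>B. c b * b x)"
proof -
  obtain c where c: "h = (\<Sum>b\<in>B. (\<lambda>x. c b * b x))"
    using h unfolding cfun.span_finite[OF B] by auto
  have "(\<Sum>b\<in>B. (\<lambda>x. c b * b x)) = (\<lambda>x. \<Sum>b\<in>B. c b * b x)"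
    using B by (induction B rule: finite_induct) (auto simp: fun_eq_iff)
  with c that show ?thesis by simp
qed

lemma lin_indep_mod_appendD:
  assumes "lin_indep_mod Z (us @ vs)" shows "lin_indep_mod Z us"
  unfolding lin_indep_mod_def
proof (intro allI impI)
  fix \<alpha> :: "nat \<Rightarrow> complex" and i
  assume Z: "(\<lambda>x. \<Sum>i<length us. \<alpha> i * (us ! i) x) \<in> Z" and i: "i < length us"
  define \<beta> where "\<beta> = (\<lambda>i. if i < length us then \<alpha> i else 0)"
  have "(\<Sum>i<length (us @ vs). \<beta> i * ((us @ vs) ! i) x) = (\<Sum>i<length us. \<alpha> i * (us ! i) x)" for x
    by (rule sum.mono_neutral_cong_right) (auto simp: \<beta>_def nth_append)
  with Z have "(\<lambda>x. \<Sum>i<length (us @ vs). \<beta> i * ((us @ vs) ! i) x) \<in> Z" by simp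
  with assms have "\<beta> i = 0" using i by (simp add: lin_indep_mod_def)
  then show "\<alpha> i = 0" using i by (simp add: \<beta>_def)
qed

lemma sform_eq_zero_on_self_adjoint:
  assumes "regular_expr E" "D \<subseteq> Dmax E" "self_adjoint_op E (ell E) D" "f \<in> D" "g \<in> D"
  shows "sform E f g = 0"
proof -
  have "f \<in> Dmax E" "g \<in> Dmax E" using assms by auto
  then show ?thesis
    by (simp add: sform_eq_ip assms(1) self_adjoint_symmetric[OF assms(3,2,4,5)])
qed

text \<open>The Gram matrix \<open>A\<close> of the \<open>ws\<close> against a basis of the defect space is square. A row relation of
  \<open>A\<close> produces a combination of the \<open>ws\<close> that the form annihilates on the defect space and on \<open>D\<close>, hence
  on all of the maximal domain; it lies in the minimal domain and is trivial. So the columns are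
  independent too: an element of the defect space that pairs to zero with all \<open>ws\<close> is zero, and the
  conditions \<open>ws\<close> remove from \<open>f = h + g\<close> its component \<open>h\<close> outside \<open>D\<close>.\<close>

lemma isotropic_independent_imp_GKN:
  assumes reg: "regular_expr E" and sub: "cfun.subspace D" and D: "D \<subseteq> Dmax E"
    and iso: "\<And>f g. f \<in> D \<Longrightarrow> g \<in> D \<Longrightarrow> sform E f g = 0"
    and decomp: "\<And>f. f \<in> Dmax E \<Longrightarrow> \<exists>g\<in>D. \<exists>h\<in>Dplus E. f = (\<lambda>x. h x + g x)"
    and dim: "has_complex_dim (Dplus E) (length ws)"
    and ws: "set ws \<subseteq> D" and indep: "lin_indep_mod (Dmin E) ws"
  shows "given_by_GKN E D ws"
proof -
  obtain B where B: "finite B" "card B = length ws" "cfun.span B = Dplus E"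
    using dim unfolding has_complex_dim_def by blast
  define I where "I = {..<length ws}"
  have wD: "ws ! i \<in> D" if "i \<in> I" for i using ws that by (auto simp: I_def)
  have wmax: "ws ! i \<in> Dmax E" if "i \<in> I" for i using wD[OF that] D by blast
  have zero: "(\<lambda>x. 0) \<in> Dmax E"
    using cfun.subspace_0[OF sub] D by (auto simp: zero_fun_def)
  have Bplus: "b \<in> Dmax E" if "b \<in> B" for b
    using cfun.span_base[OF that] B(3) by (auto simp: Dplus_def)
  define A where "A = (\<lambda>i b. sform E b (ws ! i))"
  have left: "\<forall>i\<in>I. c i = 0" if c: "\<forall>b\<in>B. (\<Sum>i\<in>I. c i * A i b) = 0" for c
  proof -
    \<comment> \<open>conjugated because \<open>A\<close> has the \<open>ws\<close> in the conjugate linear argument of the form\<close>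
    define d where "d = (\<lambda>i. cnj (c i))"
    define u where "u = (\<lambda>x. \<Sum>i\<in>I. d i * (ws ! i) x)"
    have fin: "finite I" by (simp add: I_def)
    have umax: "u \<in> Dmax E"
      unfolding u_def by (rule sform_sum_left(1)[OF reg fin zero wmax])
    have comb: "sform E u f = (\<Sum>i\<in>I. d i * sform E (ws ! i) f)" if "f \<in> Dmax E" for f
      unfolding u_def by (rule sform_sum_left(2)[OF reg fin zero wmax that])
    have uB: "sform E u b = 0" if b: "b \<in> B" for b
    proof -
      have "sform E u b = - cnj (\<Sum>i\<in>I. c i * A i b)"
        unfolding comb[OF Bplus[OF b]] A_def d_def cnj_sum sum_negf[symmetric]
        using sform_skew[OF reg Bplus[OF b] wmax] by (intro sum.cong) auto
      with c b show ?thesis by simp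
    qed
    have "sform E u f = 0" if f: "f \<in> Dmax E" for f
    proof -
      obtain g h where g: "g \<in> D" and h: "h \<in> Dplus E" and fgh: "f = (\<lambda>x. h x + g x)"
        using decomp[OF f] by blast
      have gmax: "g \<in> Dmax E" and hmax: "h \<in> Dmax E" using g h D by (auto simp: Dplus_def)
      obtain \<beta> where \<beta>: "h = (\<lambda>x. \<Sum>b\<in>B. \<beta> b * b x)"
        using cfun_span_finite[OF B(1)] h B(3) by blast
      have "sform E h u = 0"
        unfolding \<beta> using sform_sum_left(2)[OF reg B(1) zero, of "\<lambda>b. b"] Bplus umax
          sform_skew[OF reg umax] uB by simp
      moreover have "sform E g u = (\<Sum>i\<in>I. 0)"
        unfolding sform_skew[OF reg umax gmax] using comb[OF gmax] iso[OF wD g] by simp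
      ultimately have "sform E f u = 0"
        using sform_lincomb_left[OF reg hmax gmax umax, of 1] by (simp add: fgh)
      then show ?thesis using sform_skew[OF reg f umax] by simp
    qed
    with umax have "u \<in> Dmin E" by (simp add: Dmin_def)
    with indep show ?thesis by (auto simp: lin_indep_mod_def u_def I_def d_def)
  qed
  have "f \<in> D" if f: "f \<in> Dmax E" and zero_ws: "\<forall>v\<in>set ws. sform E f v = 0" for f
  proof -
    obtain g h where g: "g \<in> D" and h: "h \<in> Dplus E" and fgh: "f = (\<lambda>x. h x + g x)"
      using decomp[OF f] by blast
    have gmax: "g \<in> Dmax E" and hmax: "h \<in> Dmax E" using g h D by (auto simp: Dplus_def)
    obtain \<beta> where \<beta>: "h = (\<lambda>x. \<Sum>b\<in>B. \<beta> b * b x)"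
      using cfun_span_finite[OF B(1)] h B(3) by blast
    have "(\<Sum>b\<in>B. A i b * \<beta> b) = 0" if i: "i \<in> I" for i
    proof -
      have "(\<Sum>b\<in>B. A i b * \<beta> b) = (\<Sum>b\<in>B. \<beta> b * sform E b (ws ! i))"
        by (simp add: A_def mult.commute)
      also have "\<dots> = sform E h (ws ! i)"
        unfolding \<beta> by (rule sform_sum_left(2)[OF reg B(1) zero Bplus wmax[OF i], symmetric])
      also have "\<dots> = sform E f (ws ! i)"
        using sform_lincomb_left[OF reg hmax gmax wmax[OF i], of 1] iso[OF g wD[OF i]]
        by (simp add: fgh)
      also have "\<dots> = 0" using zero_ws i by (simp add: I_def)
      finally show ?thesis .
    qed
    then have "\<forall>b\<in>B. \<beta> b = 0"
      using square_system_left_inj_imp_right_inj[of I B A \<beta>] left B by (auto simp: I_def)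
    then have "f = g" by (simp add: fgh \<beta>)
    with g show ?thesis by simp
  qed
  then have "D = {f \<in> Dmax E. \<forall>v\<in>set ws. sform E f v = 0}"
    using D ws iso by blast
  then show ?thesis
    using D ws iso indep unfolding given_by_GKN_def by blast
qed

theorem theorem3p2:
  fixes E :: diff_expr and m :: nat and DL :: "(real \<Rightarrow> complex) set"
    and P :: "nat \<Rightarrow> real \<Rightarrow> complex" and ks :: "nat list" and fs :: "(real \<Rightarrow> complex) list"
  assumes "regular_expr E" and "formally_symmetric E"
    and "Dmin E \<subseteq> DL" and "DL \<subseteq> Dmax E"
    and "self_adjoint_op E (ell E) DL"
    and "deficiency_indices E m m"
    and "complete_orthogonal_eigenfunctions E (ell E) DL P"
    and "length ks = m" and "length fs = m" and "set fs \<subseteq> Dmax E"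
    and "basis_mod (Dmin E) (defect_sum E) (map P ks @ fs)"
  shows "given_by_GKN E DL (map P ks)"
proof (rule isotropic_independent_imp_GKN[OF assms(1) _ assms(4)])
  show "cfun.subspace DL" using assms(5) by (simp add: self_adjoint_op_def)
  show "sform E f g = 0" if "f \<in> DL" "g \<in> DL" for f g
    using that by (rule sform_eq_zero_on_self_adjoint[OF assms(1,4,5)])
  show "\<exists>g\<in>DL. \<exists>h\<in>Dplus E. f = (\<lambda>x. h x + g x)" if "f \<in> Dmax E" for f
    using Dmax_eq_self_adjoint_plus_Dplus[OF assms(1,4,5,7) that] by blast
  show "has_complex_dim (Dplus E) (length (map P ks))"
    using assms(6,8) by (simp add: deficiency_indices_def)
  show "set (map P ks) \<subseteq> DL"
    using assms(7) by (auto simp: complete_orthogonal_eigenfunctions_def)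
  show "lin_indep_mod (Dmin E) (map P ks)"
    using assms(11) by (auto simp: basis_mod_def intro: lin_indep_mod_appendD)
qed

end
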